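(* Let $\mathcal{J}(u)=\frac12\|u^+\|^2-\mathcal{I}(u)$ be a functional on $X=X^+\oplus\widetilde X$ as in the context. Suppose $\mathcal{J}\in C^1(X,\mathbb{R})$ satisfies the conditions (I1)–(I8) listed in the context. Then: (a) $c_{\mathcal{M}}\ge a>0$ and $\widetilde{\mathcal{J}}$ has a Cerami sequence $(u_n)\subset X^+$ at the level $c_{\mathcal{M}}$, i.e. $(1+\|u_n\|)\widetilde{\mathcal{J}}'(u_n)\to0$ and $\widetilde{\mathcal{J}}(u_n)\to c_{\mathcal{M}}$. (b) $c_{\mathcal{M}}=c_{\mathcal{N}}:=\inf_{\mathcal{N}}\mathcal{J}$.
   Context: $X$ is a reflexive Banach space with norm $\|\cdot\|$ and a topological direct sum decomposition $X=X^+\oplus\widetilde X$, where $X^+$ is a Hilbert space with scalar product $\langle\cdot,\cdot\rangle$. For $u\in X$ write $u=u^++\widetilde u$ with $u^+\in X^+$, $\widetilde u\in\widetilde X$; one has $\langle u,u\rangle=\|u\|^2$ for $u\in X^+$ and $\|u\|^2=\|u^+\|^2+\|\widetilde u\|^2$ for $u\in X$. The topology $\mathcal{T}$ on $X$ is the product of the norm topology on $X^+$ and the weak topology on $\widetilde X$; thus $u_n\xrightarrow{\mathcal{T}}u$ means $u_n^+\to u^+$ and $\widetilde u_n\rightharpoonup\widetilde u$. Put $\mathcal{J}(u)=\frac12\|u^+\|^2-\mathcal{I}(u)$, $\mathcal{M}=\{u\in X:\mathcal{J}'(u)|_{\widetilde X}=0\}=\{u\in X:\mathcal{I}'(u)|_{\widetilde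 X}=0\}$ and $\mathcal{N}=\{u\in X\setminus\widetilde X:\mathcal{J}'(u)|_{\mathbb{R}u\oplus\widetilde X}=0\}$. Conditions: (I1) $\mathcal{I}\in C^1(X,\mathbb{R})$ and $\mathcal{I}(u)\ge\mathcal{I}(0)=0$ for any $u\in X$. (I2) $u_n\xrightarrow{\mathcal{T}}u$ implies $\liminf\mathcal{I}(u_n)\ge\mathcal{I}(u)$. (I3) If $u_n\xrightarrow{\mathcal{T}}u$ and $\mathcal{I}(u_n)\to\mathcal{I}(u)$, then $u_n\to u$. (I4) $\|u^+\|+\mathcal{I}(u)\to\infty$ as $\|u\|\to\infty$. (I5) If $u\in\mathcal{M}$, then $\mathcal{I}(u)<\mathcal{I}(u+v)$ for every $v\in\widetilde X\setminus\{0\}$. (I6) There exists $r>0$ such that $a:=\inf_{u\in X^+,\|u\|=r}\mathcal{J}(u)>0$ ($a$ being a real number, so in particular $X^+\ne\{0\}$). (I7) $\mathcal{I}(t_nu_n)/t_n^2\to\infty$ if $t_n\to\infty$ and $u_n^+\to u^+\ne0$ as $n\to\infty$. (I8) $\frac{t^2-1}2\mathcal{I}'(u)[u]+\mathcal{I}(u)-\mathcal{I}(tu+v)=\frac{t^2-1}2\mathcal{I}'(u)[u]+t\,\mathcal{I}'(u)[v]+\mathcal{I}(u)-\mathcal{I}(tu+v)\le0$ for every $u\in\mathcal{N}$, $t\ge0$, $v\in\widetilde X$. For each $u\in X^+$, $m(u)$ denotes the unique element of $\mathcal{M}\cap(u+\widetilde X)$; it is the unique minimizer of $\mathcal{I}$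 on $u+\widetilde X$, equivalently the unique global maximizer of $\mathcal{J}|_{u+\widetilde X}$. The map $m:X^+\to\mathcal{M}$ is a homeomorphism with inverse $u\mapsto u^+$. Put $\widetilde{\mathcal{J}}:=\mathcal{J}\circ m:X^+\to\mathbb{R}$; it is of class $C^1$ with $\widetilde{\mathcal{J}}'(u)=\mathcal{J}'(m(u))|_{X^+}$. With $r$ and $a$ as in (I6), $c_{\mathcal{M}}:=\inf_{\gamma\in\Gamma}\sup_{t\in[0,1]}\mathcal{J}(\gamma(t))$, where $\Gamma:=\{\gamma\in C([0,1],\mathcal{M}):\gamma(0)=0,\ \|\gamma(1)^+\|>r\text{ and }\mathcal{J}(\gamma(1))<0\}$. *)

theory Defs
  imports "HOL-Analysis.Analysis"
begin

text \<open>
  The decomposition of \<open>X\<close> is internal: \<open>X\<close> is the type \<open>'a\<close>, and \<open>P\<close>, \<open>T\<close> stand for the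
  subspaces \<open>X\<^sup>+\<close> and \<open>X\<close> tilde.
\<close>

definition reflexive_space :: "'a::real_normed_vector itself \<Rightarrow> bool" where
  "reflexive_space _ \<longleftrightarrow>
     (\<forall>\<phi> :: ('a \<Rightarrow>\<^sub>L real) \<Rightarrow>\<^sub>L real. \<exists>x::'a. \<forall>f. blinfun_apply \<phi> f = blinfun_apply f x)"

definition plus_part :: "'a::real_normed_vector set \<Rightarrow> 'a set \<Rightarrow> 'a \<Rightarrow> 'a" where
  "plus_part P T u = (THE v. v \<in> P \<and> u - v \<in> T)"

definition tilde_part :: "'a::real_normed_vector set \<Rightarrow> 'a set \<Rightarrow> 'a \<Rightarrow> 'a" where
  "tilde_part P T u = u - plus_part P T u"

definition topological_direct_sum :: "'a::real_normed_vector set \<Rightarrow> 'a set \<Rightarrow> bool" where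
  "topological_direct_sum P T \<longleftrightarrow>
     subspace P \<and> subspace T \<and> P \<inter> T = {0} \<and> (\<forall>u. \<exists>v\<in>P. \<exists>w\<in>T. u = v + w) \<and>
     continuous_on UNIV (plus_part P T) \<and> continuous_on UNIV (tilde_part P T)"

text \<open>\<open>ip\<close> is a scalar product on \<open>P\<close> that induces the norm of the ambient space;
  its values outside \<open>P\<close> are irrelevant.\<close>

definition hilbert_subspace :: "'a::real_normed_vector set \<Rightarrow> ('a \<Rightarrow> 'a \<Rightarrow> real) \<Rightarrow> bool" where
  "hilbert_subspace P ip \<longleftrightarrow>
     subspace P \<and> complete P \<and>
     (\<forall>u\<in>P. \<forall>v\<in>P. ip u v = ip v u) \<and>
     (\<forall>u\<in>P. \<forall>v\<in>P. \<forall>w\<in>P. ip (u + v) w = ip u w + ip v w) \<and>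
     (\<forall>c. \<forall>u\<in>P. \<forall>v\<in>P. ip (c *\<^sub>R u) v = c * ip u v) \<and>
     (\<forall>u\<in>P. ip u u = (norm u)\<^sup>2)"

definition weakly_tendsto :: "(nat \<Rightarrow> 'a::real_normed_vector) \<Rightarrow> 'a \<Rightarrow> bool" where
  "weakly_tendsto U u \<longleftrightarrow>
     (\<forall>f :: 'a \<Rightarrow>\<^sub>L real. (\<lambda>n. blinfun_apply f (U n)) \<longlonglongrightarrow> blinfun_apply f u)"

text \<open>Testing against functionals on all of \<open>X\<close> gives weak convergence in \<open>T\<close>: every bounded
  functional on \<open>T\<close> extends to \<open>X\<close> by composition with the bounded projection onto \<open>T\<close>.\<close>

definition T_tendsto ::
  "'a::real_normed_vector set \<Rightarrow> 'a set \<Rightarrow> (nat \<Rightarrow> 'a) \<Rightarrow> 'a \<Rightarrow> bool" where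
  "T_tendsto P T U u \<longleftrightarrow>
     (\<lambda>n. plus_part P T (U n)) \<longlonglongrightarrow> plus_part P T u \<and>
     weakly_tendsto (\<lambda>n. tilde_part P T (U n)) (tilde_part P T u)"

definition C1_functional :: "('a::real_normed_vector \<Rightarrow> real) \<Rightarrow> bool" where
  "C1_functional F \<longleftrightarrow>
     (\<exists>F' :: 'a \<Rightarrow> 'a \<Rightarrow>\<^sub>L real.
        (\<forall>u. (F has_derivative blinfun_apply (F' u)) (at u)) \<and> continuous_on UNIV F')"

definition J_fun ::
  "'a::real_normed_vector set \<Rightarrow> 'a set \<Rightarrow> ('a \<Rightarrow> real) \<Rightarrow> 'a \<Rightarrow> real" where
  "J_fun P T I u = 1 / 2 * (norm (plus_part P T u))\<^sup>2 - I u"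

definition M_set :: "'a::real_normed_vector set \<Rightarrow> 'a set \<Rightarrow> ('a \<Rightarrow> real) \<Rightarrow> 'a set" where
  "M_set P T I = {u. \<forall>v\<in>T. frechet_derivative (J_fun P T I) (at u) v = 0}"

definition N_set :: "'a::real_normed_vector set \<Rightarrow> 'a set \<Rightarrow> ('a \<Rightarrow> real) \<Rightarrow> 'a set" where
  "N_set P T I =
     {u. u \<notin> T \<and>
         (\<forall>s. \<forall>v\<in>T. frechet_derivative (J_fun P T I) (at u) (s *\<^sub>R u + v) = 0)}"

definition m_map :: "'a::real_normed_vector set \<Rightarrow> 'a set \<Rightarrow> ('a \<Rightarrow> real) \<Rightarrow> 'a \<Rightarrow> 'a" where
  "m_map P T I u = (THE w. w \<in> M_set P T I \<and> (\<exists>v\<in>T. w = u + v))"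

text \<open>Only the values on \<open>P\<close> matter.\<close>

definition Jtilde ::
  "'a::real_normed_vector set \<Rightarrow> 'a set \<Rightarrow> ('a \<Rightarrow> real) \<Rightarrow> 'a \<Rightarrow> real" where
  "Jtilde P T I u = J_fun P T I (m_map P T I u)"

definition Gamma_paths ::
  "'a::real_normed_vector set \<Rightarrow> 'a set \<Rightarrow> ('a \<Rightarrow> real) \<Rightarrow> real \<Rightarrow> (real \<Rightarrow> 'a) set" where
  "Gamma_paths P T I r =
     {\<gamma>. continuous_on {0..1} \<gamma> \<and> \<gamma> ` {0..1} \<subseteq> M_set P T I \<and> \<gamma> 0 = 0 \<and>
         norm (plus_part P T (\<gamma> 1)) > r \<and> J_fun P T I (\<gamma> 1) < 0}"

text \<open>Infima and suprema are taken in the extended reals, so that empty or unbounded sets do not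
  yield arbitrary values.\<close>

definition c_M ::
  "'a::real_normed_vector set \<Rightarrow> 'a set \<Rightarrow> ('a \<Rightarrow> real) \<Rightarrow> real \<Rightarrow> ereal" where
  "c_M P T I r = (INF \<gamma>\<in>Gamma_paths P T I r. SUP t\<in>{0..1}. ereal (J_fun P T I (\<gamma> t)))"

definition c_N :: "'a::real_normed_vector set \<Rightarrow> 'a set \<Rightarrow> ('a \<Rightarrow> real) \<Rightarrow> ereal" where
  "c_N P T I = (INF u\<in>N_set P T I. ereal (J_fun P T I u))"

definition dual_norm_on :: "'a::real_normed_vector set \<Rightarrow> ('a \<Rightarrow> real) \<Rightarrow> real" where
  "dual_norm_on S f = (SUP v\<in>{v\<in>S. norm v \<le> 1}. \<bar>f v\<bar>)"

text \<open>For a subspace \<open>S\<close>, the derivative of \<open>F\<close> at a point of \<open>S\<close> within \<open>S\<close> is determined on \<open>S\<close>,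
  and \<open>dual_norm_on\<close> only sees its restriction to \<open>S\<close>, that is, the Frechet derivative of
  \<open>F\<close> as a functional on the normed space \<open>S\<close>.\<close>

definition cerami_sequence_on ::
  "'a::real_normed_vector set \<Rightarrow> ('a \<Rightarrow> real) \<Rightarrow> real \<Rightarrow> (nat \<Rightarrow> 'a) \<Rightarrow> bool" where
  "cerami_sequence_on S F c U \<longleftrightarrow>
     (\<forall>n. U n \<in> S) \<and>
     (\<exists>D. (\<forall>n. (F has_derivative D n) (at (U n) within S)) \<and>
          (\<lambda>n. (1 + norm (U n)) * dual_norm_on S (D n)) \<longlonglongrightarrow> 0) \<and>
     (\<lambda>n. F (U n)) \<longlonglongrightarrow> c"

end

theory Submission
  imports Defs "HOL-Library.Diagonal_Subsequence"
begin

text \<open>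
  Write \<open>\<Phi>\<close> for the reduced functional on \<open>X\<^sup>+\<close>. By (I8) a critical point of \<open>t \<mapsto> \<Phi> (t w)\<close>, \<open>t > 0\<close>,
  is a point of the Nehari set and hence a global maximum on the ray, so that \<open>\<Phi>\<close> is
  quasi-concave on every ray from the origin. Rays give \<open>c\<^sub>M \<le> c\<^sub>N\<close>; conversely the
  radial derivative changes sign along every admissible path, which therefore meets the Nehari set.

  No deformation is needed for the Cerami sequence. Ekeland's principle, applied to
  \<open>\<Psi> w = max \<Phi> (t w)\<close> on the unit sphere of \<open>X\<^sup>+\<close>, yields almost minimizers \<open>w\<close> such that for every
  direction \<open>h\<close> some maximizer \<open>t\<close> satisfies \<open>t \<Phi>'(t w)[h] \<ge> - \<epsilon> \<parallel>h\<parallel>\<close>. Quasi-concavity of the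
  neighbouring rays forces \<open>t \<Phi>'(t w)\<close> to run through a line segment as \<open>t\<close> runs through the
  maximizers, so a separation argument in the plane produces one \<open>t\<close> that works for all \<open>h\<close>.
  The factor \<open>t = \<parallel>t w\<parallel>\<close> is exactly the weight in Cerami's condition.
\<close>

section \<open>Hahn-Banach and weak sequential compactness\<close>

text \<open>The inequality in (I8) is not strict, so a ray may carry a whole interval of maximizers.
  Then \<open>\<Psi>\<close> need not be differentiable on the unit sphere, and a near minimizer of
  it does not by itself single out an almost critical point of \<open>\<Phi>\<close>; this is why
  Ekeland's principle, which asks only for lower semicontinuity, is followed by a separation
  argument. The infimum of \<open>\<Psi>\<close> on the sphere is \<open>c_N\<close>: ray maxima
  give points of the Nehari set, and every Nehari point dominates its whole ray. Weak compactness
  serves to construct \<open>m\<close>: minimizers on the fibres \<open>u + T\<close> exist by (I2),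
  and (I3) upgrades convergence of minimizers to norm convergence, which makes \<open>m\<close>
  continuous. In the Cerami weight \<open>1 + norm u\<close> the summand \<open>1\<close> is
  absorbed because \<open>\<Phi> < a\<close> near \<open>0\<close> keeps maximizers away from
  \<open>0\<close>. The factor 2 in the bounds \<open>2 * e\<close> is the price of pulling nearby
  points back to the unit sphere.\<close>

definition sublinear :: "('a::real_vector \<Rightarrow> real) \<Rightarrow> bool" where
  "sublinear p \<longleftrightarrow> (\<forall>x y. p (x + y) \<le> p x + p y) \<and> (\<forall>c>0. \<forall>x. p (c *\<^sub>R x) \<le> c * p x)"

text \<open>The definition asks only for \<open>\<le>\<close> at positive scalars, which is what
  infima satisfy readily; the reverse inequality is the same one at the scalar
  \<open>1/c\<close>.\<close>

lemma sublinearD: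
  assumes "sublinear p"
  shows "p (x + y) \<le> p x + p y" and "p 0 = 0" and "- p (- x) \<le> p x"
    and "0 \<le> c \<Longrightarrow> p (c *\<^sub>R x) = c * p x"
proof -
  show add: "p (x + y) \<le> p x + p y" for x y using assms by (simp add: sublinear_def)
  have le: "p (c *\<^sub>R x) \<le> c * p x" if "c > 0" for c x using assms that by (simp add: sublinear_def)
  have "p 0 \<ge> 0" using add[of 0 0] by simp
  moreover have "p 0 \<le> 0" using le[of "1/2" 0] by simp
  ultimately show zero: "p 0 = 0" by simp
  show "- p (- x) \<le> p x" using add[of x "-x"] zero by simp
  show "p (c *\<^sub>R x) = c * p x" if "0 \<le> c"
  proof (cases "c = 0")
    case False
    then have "c > 0" using that by simp
    then have "p ((1/c) *\<^sub>R (c *\<^sub>R x)) \<le> 1/c * p (c *\<^sub>R x)" by (intro le) simp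
    then have "c * p x \<le> p (c *\<^sub>R x)" using \<open>c > 0\<close> by (simp add: field_simps)
    with le[OF \<open>c > 0\<close>, of x] show ?thesis by simp
  qed (simp add: zero)
qed

text \<open>\<open>q\<close> is the largest sublinear minorant of \<open>p\<close> whose value at
  \<open>- y\<close> is at most \<open>- p y\<close>, so every linear functional below it agrees
  with \<open>p\<close> at \<open>y\<close>. The real infimum is meaningful because
  \<open>- p (- x)\<close> is a lower bound.\<close>

lemma sublinear_shift:
  fixes p :: "'a::real_vector \<Rightarrow> real" and y :: 'a
  assumes p: "sublinear p"
  defines "q \<equiv> \<lambda>x. INF t\<in>{0..}. p (x + t *\<^sub>R y) - t * p y"
  shows "sublinear q" and "q x \<le> p x" and "q (- y) \<le> - p y"
    and "t \<ge> 0 \<Longrightarrow> q x \<le> p (x + t *\<^sub>R y) - t * p y"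
proof -
  have q_eq: "q x = (INF t\<in>{0..}. p (x + t *\<^sub>R y) - t * p y)" for x by (simp add: q_def)
  have lower: "- p (- x) \<le> p (x + t *\<^sub>R y) - t * p y" if "t \<ge> 0" for t x
    using sublinearD(1)[OF p, of "x + t *\<^sub>R y" "- x"] sublinearD(4)[OF p that, of y] by simp
  have upper: "q x \<le> p (x + t *\<^sub>R y) - t * p y" if "t \<ge> 0" for t x
    unfolding q_def by (rule cINF_lower) (use that lower in \<open>auto intro!: bdd_belowI2\<close>)
  then show "t \<ge> 0 \<Longrightarrow> q x \<le> p (x + t *\<^sub>R y) - t * p y" .
  show "q x \<le> p x" using upper[of 0 x] by simp
  show "q (- y) \<le> - p y" using upper[of 1 "- y"] sublinearD(2)[OF p] by simp
  have "q (x1 + x2) \<le> q x1 + q x2" for x1 x2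
  proof -
    have *: "q (x1 + x2) \<le> (p (x1 + s *\<^sub>R y) - s * p y) + (p (x2 + t *\<^sub>R y) - t * p y)"
      if "s \<ge> 0" "t \<ge> 0" for s t
      using upper[of "s + t" "x1 + x2"] sublinearD(1)[OF p, of "x1 + s *\<^sub>R y" "x2 + t *\<^sub>R y"] that
      by (simp add: algebra_simps)
    have "q (x1 + x2) - (p (x2 + t *\<^sub>R y) - t * p y) \<le> q x1" if "t \<ge> 0" for t
      unfolding q_eq[of x1]
      by (rule cINF_greatest) (use *[OF _ that] in \<open>auto simp: algebra_simps\<close>)
    then have "q (x1 + x2) - q x1 \<le> (p (x2 + t *\<^sub>R y) - t * p y)" if "t \<ge> 0" for t
      using that by (simp add: algebra_simps)
    then have "q (x1 + x2) - q x1 \<le> q x2"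
      unfolding q_eq[of x2] by (intro cINF_greatest) auto
    then show ?thesis by simp
  qed
  moreover have "q (c *\<^sub>R x) \<le> c * q x" if "c > 0" for c x
  proof -
    have "q (c *\<^sub>R x) / c \<le> p (x + t *\<^sub>R y) - t * p y" if "t \<ge> 0" for t
      using upper[of "c * t" "c *\<^sub>R x"] sublinearD(4)[OF p, of c "x + t *\<^sub>R y"] \<open>c > 0\<close> that
      by (simp add: field_simps scaleR_add_right)
    then have "q (c *\<^sub>R x) / c \<le> q x" unfolding q_eq[of x] by (intro cINF_greatest) auto
    with that show ?thesis by (simp add: field_simps)
  qed
  ultimately show "sublinear q" unfolding sublinear_def by blast
qed

text \<open>Zorn's lemma for the reversed order: a chain is bounded by its pointwise infimum, which
  is finite since every member lies above \<open>- p (- x)\<close>.\<close>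

lemma minimal_sublinear_exists:
  fixes p :: "'a::real_vector \<Rightarrow> real"
  assumes p: "sublinear p"
  shows "\<exists>q. sublinear q \<and> q \<le> p \<and> (\<forall>q'. sublinear q' \<longrightarrow> q' \<le> q \<longrightarrow> q' = q)"
proof -
  define A where "A = {q. sublinear q \<and> q \<le> p}"
  have "\<exists>m\<in>A. \<forall>a\<in>A. a \<le> m \<longrightarrow> a = m"
  proof (rule predicate_Zorn)
    show "partial_order_on A (relation_of (\<lambda>x y. y \<le> x) A)"
      by (rule partial_order_on_relation_ofI) auto
  next
    fix C assume C: "C \<in> Chains (relation_of (\<lambda>x y. y \<le> x) A)"
    have CA: "q \<in> A" if "q \<in> C" for q
      using Chains_relation_of[OF C] that by auto
    have total: "q1 \<le> q2 \<or> q2 \<le> q1" if "q1 \<in> C" "q2 \<in> C" for q1 q2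
      using C that unfolding Chains_def relation_of_def by auto
    show "\<exists>u\<in>A. \<forall>a\<in>C. u \<le> a"
    proof (cases "C = {}")
      case True
      have "p \<in> A" using p by (simp add: A_def)
      with True show ?thesis by blast
    next
      case False
      define u where "u x = (INF q\<in>C. q x)" for x
      have u_le: "u x \<le> q x" if "q \<in> C" for q x
        unfolding u_def
      proof (rule cINF_lower[OF bdd_belowI2 that])
        fix q assume "q \<in> C"
        then have "sublinear q" "q \<le> p" using CA by (auto simp: A_def)
        then show "- p (- x) \<le> q x" using sublinearD(3)[of q x] le_funD[of q p "- x"] by simp
      qed
      have "u (x + y) \<le> u x + u y" for x y
      proof -
        have *: "u (x + y) \<le> q1 x + q2 y" if q: "q1 \<in> C" "q2 \<in> C" for q1 q2
        proof -
          \<comment> \<open>Subadditivity of the infimum needs one member below both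
            \<open>q1\<close> and \<open>q2\<close>; in a chain the smaller of the two will
            do.\<close>
          obtain q where "q \<in> C" "q \<le> q1" "q \<le> q2" using total[OF q] q by blast
          then have "u (x + y) \<le> q x + q y"
            using u_le[of q "x + y"] CA[of q] sublinearD(1)[of q x y] by (simp add: A_def)
          with \<open>q \<le> q1\<close> \<open>q \<le> q2\<close> show ?thesis by (smt (verit) le_funD)
        qed
        have "u (x + y) - q2 y \<le> u x" if "q2 \<in> C" for q2
          unfolding u_def[of x]
          by (rule cINF_greatest[OF False]) (use *[OF _ that] in \<open>auto simp: algebra_simps\<close>)
        then have "u (x + y) - u x \<le> q2 y" if "q2 \<in> C" for q2
          using that by (simp add: algebra_simps)
        then have "u (x + y) - u x \<le> u y" unfolding u_def[of y] by (intro cINF_greatest[OF False])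
        then show ?thesis by simp
      qed
      moreover have "u (c *\<^sub>R x) \<le> c * u x" if "c > 0" for c x
      proof -
        have "u (c *\<^sub>R x) / c \<le> q x" if "q \<in> C" for q
          using u_le[OF that, of "c *\<^sub>R x"] CA[OF that] sublinearD(4)[of q c x] \<open>c > 0\<close>
          by (simp add: A_def field_simps)
        then have "u (c *\<^sub>R x) / c \<le> u x" unfolding u_def[of x] by (intro cINF_greatest[OF False])
        with that show ?thesis by (simp add: field_simps)
      qed
      ultimately have "sublinear u" by (simp add: sublinear_def)
      moreover obtain q where "q \<in> C" using False by blast
      then have "u \<le> p" using u_le CA by (metis (mono_tags, lifting) A_def le_funI mem_Collect_eq order_trans)
      ultimately show ?thesis using u_le by (intro bexI[of _ u]) (auto simp: A_def le_fun_def)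
    qed
  qed
  then show ?thesis unfolding A_def by (metis (mono_tags, lifting) mem_Collect_eq order_trans)
qed

text \<open>The functional \<open>q\<close> of sublinear_shift cannot lie strictly below a minimal one,
  which makes the latter superadditive.\<close>

lemma hahn_banach:
  fixes p :: "'a::real_vector \<Rightarrow> real"
  assumes p: "sublinear p"
  shows "\<exists>f. linear f \<and> (\<forall>x. f x \<le> p x)"
proof -
  obtain f where f: "sublinear f" "f \<le> p" and min: "\<And>q. sublinear q \<Longrightarrow> q \<le> f \<Longrightarrow> q = f"
    using minimal_sublinear_exists[OF p] by blast
  have add: "f (x + y) = f x + f y" for x y
  proof -
    define q where "q x = (INF t\<in>{0..}. f (x + t *\<^sub>R y) - t * f y)" for x
    have "q = f" unfolding q_def
      by (rule min) (use sublinear_shift[OF f(1)] in \<open>auto simp: le_fun_def\<close>)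
    moreover have "q x \<le> f (x + 1 *\<^sub>R y) - 1 * f y"
      unfolding q_def by (rule sublinear_shift(4)[OF f(1)]) simp
    ultimately have "f x + f y \<le> f (x + y)" by simp
    with sublinearD(1)[OF f(1), of x y] show ?thesis by simp
  qed
  have neg: "f (- x) = - f x" for x using add[of x "- x"] sublinearD(2)[OF f(1)] by simp
  have "f (c *\<^sub>R x) = c * f x" for c x
  proof (cases "c \<ge> 0")
    case True then show ?thesis by (rule sublinearD(4)[OF f(1)])
  next
    case False
    then have "f ((- c) *\<^sub>R x) = - c * f x" by (intro sublinearD(4)[OF f(1)]) simp
    then show ?thesis using neg[of "c *\<^sub>R x"] by simp
  qed
  with add have "linear f" by (intro linearI) auto
  with f(2) show ?thesis by (auto simp: le_fun_def)
qed

text \<open>The shift forces \<open>f (- y) \<le> - p y\<close>, that is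
  \<open>p y \<le> f y\<close>, so a linear minorant of the shifted functional touches
  \<open>p\<close> at \<open>y\<close>.\<close>

lemma hahn_banach_point:
  fixes p :: "'a::real_vector \<Rightarrow> real"
  assumes p: "sublinear p"
  shows "\<exists>f. linear f \<and> (\<forall>x. f x \<le> p x) \<and> f y = p y"
proof -
  define q where "q x = (INF t\<in>{0..}. p (x + t *\<^sub>R y) - t * p y)" for x
  have "sublinear q" unfolding q_def by (rule sublinear_shift[OF p])
  then obtain f where f: "linear f" "\<And>x. f x \<le> q x" using hahn_banach by blast
  have le: "f x \<le> p x" for x
    using f(2)[of x] sublinear_shift(2)[OF p, where x = x and y = y] by (simp add: q_def)
  have "f (- y) \<le> - p y"
    using f(2)[of "- y"] sublinear_shift(3)[OF p, where y = y] by (simp add: q_def)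
  then have "f y = p y" using le[of y] linear_neg[OF f(1), of y] by simp
  with f(1) le show ?thesis by blast
qed

text \<open>The distance to a subspace is the quotient seminorm modulo \<open>Y\<close>; both
  inequalities follow by adding or scaling almost nearest points.\<close>

lemma sublinear_infdist:
  fixes Y :: "'a::real_normed_vector set"
  assumes "subspace Y"
  shows "sublinear (\<lambda>x. infdist x Y)"
proof -
  have ne: "Y \<noteq> {}" and "0 \<in> Y" using subspace_0[OF assms] by auto
  have le: "infdist x Y \<le> norm (x - y)" if "y \<in> Y" for x y
    using infdist_le[OF that] by (simp add: dist_norm)
  have approx: "\<exists>y\<in>Y. norm (x - y) < infdist x Y + e" if "e > 0" for x and e :: real
  proof -
    have "(INF y\<in>Y. dist x y) < infdist x Y + e" using ne that by (simp add: infdist_def)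
    then show ?thesis
      by (subst (asm) cINF_less_iff) (auto simp: dist_norm ne intro!: bdd_belowI2[where m = 0])
  qed
  have "infdist (x1 + x2) Y \<le> infdist x1 Y + infdist x2 Y" for x1 x2
  proof (rule field_le_epsilon)
    fix e :: real assume "e > 0"
    then obtain y1 y2 where y: "y1 \<in> Y" "norm (x1 - y1) < infdist x1 Y + e / 2"
      "y2 \<in> Y" "norm (x2 - y2) < infdist x2 Y + e / 2"
      using approx[of "e / 2"] by (metis half_gt_zero)
    have "infdist (x1 + x2) Y \<le> norm ((x1 - y1) + (x2 - y2))"
      using le[of "y1 + y2" "x1 + x2"] subspace_add[OF assms y(1,3)] by (simp add: algebra_simps)
    also have "\<dots> \<le> norm (x1 - y1) + norm (x2 - y2)" by (rule norm_triangle_ineq)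
    finally show "infdist (x1 + x2) Y \<le> infdist x1 Y + infdist x2 Y + e" using y by simp
  qed
  moreover have "infdist (c *\<^sub>R x) Y \<le> c * infdist x Y" if c: "c > 0" for c x
  proof (rule field_le_epsilon)
    fix e :: real assume "e > 0"
    then obtain y where y: "y \<in> Y" "norm (x - y) < infdist x Y + e / c"
      using approx[OF divide_pos_pos[OF \<open>e > 0\<close> c], of x] by blast
    have "infdist (c *\<^sub>R x) Y \<le> norm (c *\<^sub>R (x - y))"
      using le[of "c *\<^sub>R y" "c *\<^sub>R x"] subspace_scale[OF assms y(1)] by (simp add: algebra_simps)
    also have "\<dots> = c * norm (x - y)" using c by simp
    also have "\<dots> \<le> c * infdist x Y + e" using y(2) c by (simp add: field_simps)
    finally show "infdist (c *\<^sub>R x) Y \<le> c * infdist x Y + e" .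
  qed
  ultimately show ?thesis by (simp add: sublinear_def)
qed

text \<open>A linear functional below the distance is nonpositive at \<open>y\<close> and at
  \<open>- y\<close> for \<open>y\<close> in \<open>Y\<close>, hence zero there. It serves to show
  that closed subspaces contain weak limits and, with \<open>Y = {0}\<close>, to produce norming
  functionals.\<close>

lemma functional_infdist:
  fixes Y :: "'a::real_normed_vector set"
  assumes "subspace Y"
  shows "\<exists>f :: 'a \<Rightarrow>\<^sub>L real. (\<forall>y\<in>Y. f y = 0) \<and> f x0 = infdist x0 Y \<and> (\<forall>x. \<bar>f x\<bar> \<le> norm x)"
proof -
  obtain f where f: "linear f" "\<And>x. f x \<le> infdist x Y" "f x0 = infdist x0 Y"
    using hahn_banach_point[OF sublinear_infdist[OF assms]] by blast
  have zero: "infdist y Y = 0" if "y \<in> Y" for y using that by simp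
  have le: "infdist x Y \<le> norm x" for x
    using infdist_le[OF subspace_0[OF assms], of x] by simp
  have bd: "\<bar>f x\<bar> \<le> norm x" for x
    using f(2)[of x] f(2)[of "- x"] le[of x] le[of "- x"] linear_neg[OF f(1), of x] by auto
  have "bounded_linear f"
    by (rule bounded_linear_intro[where K = 1]) (use f(1) bd in \<open>auto simp: linear_add linear_scale\<close>)
  moreover have "f y = 0" if "y \<in> Y" for y
    using f(2)[of y] f(2)[of "- y"] zero[OF that] zero[OF subspace_neg[OF assms that]]
      linear_neg[OF f(1), of y] by simp
  ultimately show ?thesis
    by (intro exI[of _ "Blinfun f"]) (auto simp: bounded_linear_Blinfun_apply f(3) bd)
qed

lemma norming_functional:
  fixes x :: "'a::real_normed_vector"
  shows "\<exists>f :: 'a \<Rightarrow>\<^sub>L real. f x = norm x \<and> (\<forall>y. \<bar>f y\<bar> \<le> norm y)"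
proof -
  have "infdist x {0} = norm x" by (simp add: infdist_def)
  moreover have "subspace {0 :: 'a}" by (simp add: subspace_def)
  ultimately show ?thesis using functional_infdist[of "{0}" x] by simp
qed

section \<open>Weak cluster points and weakly convergent subsequences\<close>

text \<open>\<open>p f\<close> is the upper limit of \<open>f (X n)\<close>, written as the infimum
  of eventual upper bounds so that sublinearity amounts to adding and scaling such bounds.\<close>

lemma sublinear_limsup:
  fixes X :: "nat \<Rightarrow> 'a::real_normed_vector" and f :: "'a \<Rightarrow>\<^sub>L real"
  assumes C: "\<And>n. norm (X n) \<le> C"
  defines "p \<equiv> \<lambda>f :: 'a \<Rightarrow>\<^sub>L real. Inf {c. \<forall>\<^sub>F n in sequentially. f (X n) \<le> c}"
  shows "sublinear p" and "\<forall>\<^sub>F n in sequentially. f (X n) \<le> c \<Longrightarrow> p f \<le> c"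
    and "p f \<le> norm f * C"
proof -
  have bd: "\<bar>blinfun_apply f (X n)\<bar> \<le> norm f * C" for f n
    using norm_blinfun[of f "X n"] mult_left_mono[OF C[of n] norm_ge_zero[of f]] by simp
  have low: "- (norm f * C) \<le> c" if "\<forall>\<^sub>F n in sequentially. blinfun_apply f (X n) \<le> c" for f c
    using eventually_happens'[OF sequentially_bot that] bd[of f] by (smt (verit))
  have le: "p f \<le> c" if "\<forall>\<^sub>F n in sequentially. blinfun_apply f (X n) \<le> c" for f c
    unfolding p_def by (rule cInf_lower) (use that low in \<open>auto intro!: bdd_belowI\<close>)
  then show "\<forall>\<^sub>F n in sequentially. f (X n) \<le> c \<Longrightarrow> p f \<le> c" .
  have ge: "c \<le> p f" if "\<And>d. \<forall>\<^sub>F n in sequentially. blinfun_apply f (X n) \<le> d \<Longrightarrow> c \<le> d" for c f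
  proof -
    have "norm f * C \<in> {c. \<forall>\<^sub>F n in sequentially. blinfun_apply f (X n) \<le> c}"
      using bd[of f] by (auto simp: abs_le_iff)
    then show ?thesis unfolding p_def by (intro cInf_greatest) (use that in auto)
  qed
  show "p f \<le> norm f * C" by (rule le) (use bd[of f] in \<open>auto simp: abs_le_iff\<close>)
  have "p (f + g) \<le> p f + p g" for f g
  proof -
    have "p (f + g) \<le> c + d" if "\<forall>\<^sub>F n in sequentially. blinfun_apply f (X n) \<le> c"
      "\<forall>\<^sub>F n in sequentially. blinfun_apply g (X n) \<le> d" for c d
      by (rule le, use that in eventually_elim) (simp add: blinfun.add_left)
    then have "p (f + g) - d \<le> p f" if "\<forall>\<^sub>F n in sequentially. blinfun_apply g (X n) \<le> d" for d
      using that by (intro ge) (simp add: algebra_simps)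
    then have "p (f + g) - p f \<le> p g" by (intro ge) (simp add: algebra_simps)
    then show ?thesis by simp
  qed
  moreover have "p (c *\<^sub>R f) \<le> c * p f" if "c > 0" for c f
  proof -
    have "p (c *\<^sub>R f) / c \<le> p f"
    proof (rule ge)
      fix d assume d: "\<forall>\<^sub>F n in sequentially. blinfun_apply f (X n) \<le> d"
      have "p (c *\<^sub>R f) \<le> c * d"
        by (rule le, use d in eventually_elim) (use that in \<open>simp add: blinfun.scaleR_left\<close>)
      then show "p (c *\<^sub>R f) / c \<le> d" using that by (simp add: field_simps)
    qed
    with that show ?thesis by (simp add: field_simps)
  qed
  ultimately show "sublinear p" by (simp add: sublinear_def)
qed

text \<open>A linear minorant of \<open>f \<mapsto> limsup f (X n)\<close> on the dual space is evaluation at a point.\<close>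

lemma weak_cluster_point:
  fixes X :: "nat \<Rightarrow> 'a::real_normed_vector"
  assumes refl: "reflexive_space TYPE('a)" and C: "\<And>n. norm (X n) \<le> C"
  shows "\<exists>l. \<forall>(f :: 'a \<Rightarrow>\<^sub>L real) L. (\<lambda>n. f (X n)) \<longlonglongrightarrow> L \<longrightarrow> f l = L"
proof -
  define p where "p f = Inf {c. \<forall>\<^sub>F n in sequentially. blinfun_apply f (X n) \<le> c}"
    for f :: "'a \<Rightarrow>\<^sub>L real"
  note p = sublinear_limsup[of X C, OF C, folded p_def]
  obtain F where F: "linear F" "\<And>f. F f \<le> p f" using hahn_banach[OF p(1)] by blast
  have "\<bar>F f\<bar> \<le> norm f * C" for f
    using F(2)[of f] F(2)[of "- f"] p(3)[of f] p(3)[of "- f"] linear_neg[OF F(1), of f] by auto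
  then have "bounded_linear F"
    by (intro bounded_linear_intro[where K = C]) (use F(1) in \<open>auto simp: linear_add linear_scale\<close>)
  then obtain l where l: "\<And>f. F f = blinfun_apply f l"
    using refl unfolding reflexive_space_def by (metis bounded_linear_Blinfun_apply)
  have upper: "f l \<le> L" if "(\<lambda>n. blinfun_apply f (X n)) \<longlonglongrightarrow> L"
    for f :: "'a \<Rightarrow>\<^sub>L real" and L
  proof (rule field_le_epsilon)
    fix e :: real assume "e > 0"
    then have "\<forall>\<^sub>F n in sequentially. blinfun_apply f (X n) \<le> L + e"
      using order_tendstoD(2)[OF that, of "L + e"] by (auto elim: eventually_mono)
    then show "f l \<le> L + e" using p(2)[of f "L + e"] F(2)[of f] l[of f] by simp
  qed
  have "f l = L" if "(\<lambda>n. blinfun_apply f (X n)) \<longlonglongrightarrow> L"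
    for f :: "'a \<Rightarrow>\<^sub>L real" and L
  proof -
    have "(\<lambda>n. blinfun_apply (- f) (X n)) \<longlonglongrightarrow> - L"
      using tendsto_minus[OF that] by (simp add: blinfun.minus_left)
    from upper[OF this] upper[OF that] show ?thesis by (simp add: blinfun.minus_left)
  qed
  then show ?thesis by blast
qed

text \<open>Lets a countable set closed under rational combinations have a real subspace as its
  closure.\<close>

lemma closure_scaleR_rational:
  fixes D :: "'a::real_normed_vector set"
  assumes q: "\<And>q x. x \<in> D \<Longrightarrow> real_of_rat q *\<^sub>R x \<in> D" and x: "x \<in> closure D"
  shows "c *\<^sub>R x \<in> closure D"
proof -
  have rat: "real_of_rat q *\<^sub>R x \<in> closure D" for q
  proof -
    obtain X where X: "\<And>n. X n \<in> D" "X \<longlonglongrightarrow> x" using x unfolding closure_sequential by blast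
    have "(\<lambda>n. real_of_rat q *\<^sub>R X n) \<longlonglongrightarrow> real_of_rat q *\<^sub>R x" by (intro tendsto_intros X)
    then show ?thesis
      unfolding closure_sequential using q[OF X(1)]
      by (intro exI[of _ "\<lambda>n. real_of_rat q *\<^sub>R X n"]) simp
  qed
  have "\<forall>n. \<exists>q. c < real_of_rat q \<and> real_of_rat q < c + 1 / real (Suc n)"
    by (intro allI of_rat_dense) simp
  then obtain Q where Q: "\<And>n. c < real_of_rat (Q n)" "\<And>n. real_of_rat (Q n) < c + 1 / real (Suc n)"
    by metis
  have "(\<lambda>n. c + 1 / real (Suc n)) \<longlonglongrightarrow> c + 0"
    using LIMSEQ_inverse_real_of_nat by (intro tendsto_intros) (simp add: inverse_eq_divide)
  then have "(\<lambda>n. c + 1 / real (Suc n)) \<longlonglongrightarrow> c" by simp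
  then have "(\<lambda>n. real_of_rat (Q n)) \<longlonglongrightarrow> c"
    by (rule tendsto_sandwich[rotated 3, OF _ _ _ tendsto_const])
      (use Q in \<open>auto intro!: always_eventually less_imp_le\<close>)
  then have "(\<lambda>n. real_of_rat (Q n) *\<^sub>R x) \<longlonglongrightarrow> c *\<^sub>R x" by (intro tendsto_intros)
  then show ?thesis by (rule closed_sequentially[OF closed_closure rat])
qed

lemma separable_closed_subspace:
  fixes X :: "nat \<Rightarrow> 'a::real_normed_vector"
  shows "\<exists>D. countable D \<and> D \<noteq> {} \<and> subspace (closure D) \<and> range X \<subseteq> D"
proof -
  \<comment> \<open>Rational combinations are coded by lists, so countability of \<open>D\<close> is
    that of the index type, and addition is concatenation.\<close>
  define comb where "comb xs = (\<Sum>(n, q)\<leftarrow>xs. real_of_rat q *\<^sub>R X n)" for xs :: "(nat \<times> rat) list"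
  define D where "D = range comb"
  have add: "x + y \<in> D" if "x \<in> D" "y \<in> D" for x y
  proof -
    from that obtain xs ys where "x = comb xs" "y = comb ys" by (auto simp: D_def)
    then have "x + y = comb (xs @ ys)" by (simp add: comb_def)
    then show ?thesis by (simp add: D_def)
  qed
  have scale: "real_of_rat q *\<^sub>R x \<in> D" if "x \<in> D" for q x
  proof -
    from that obtain xs where "x = comb xs" by (auto simp: D_def)
    then have "real_of_rat q *\<^sub>R x = comb (map (\<lambda>(n, s). (n, q * s)) xs)"
      unfolding comb_def
      by (induction xs arbitrary: x) (auto simp: scaleR_add_right of_rat_mult)
    then show ?thesis by (simp add: D_def)
  qed
  have "subspace (closure D)"
  proof (rule subspaceI)
    have "comb [] = 0" by (simp add: comb_def)
    then have "0 \<in> D" unfolding D_def by (metis rangeI)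
    then show "0 \<in> closure D" using closure_subset by blast
  next
    fix x y assume "x \<in> closure D" "y \<in> closure D"
    then obtain U V where "\<And>n. U n \<in> D" "U \<longlonglongrightarrow> x" "\<And>n. V n \<in> D" "V \<longlonglongrightarrow> y"
      unfolding closure_sequential by blast
    then have "(\<lambda>n. U n + V n) \<longlonglongrightarrow> x + y" "\<And>n. U n + V n \<in> D" by (auto intro: tendsto_add add)
    then show "x + y \<in> closure D"
      unfolding closure_sequential by (intro exI[of _ "\<lambda>n. U n + V n"]) auto
  next
    fix c and x assume "x \<in> closure D"
    then show "c *\<^sub>R x \<in> closure D" using closure_scaleR_rational[of D x c] scale by blast
  qed
  moreover have "X n \<in> D" for n
  proof -
    have "comb [(n, 1)] = X n" by (simp add: comb_def)
    then show ?thesis unfolding D_def by (metis rangeI)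
  qed
  ultimately show ?thesis by (intro exI[of _ D]) (auto simp: D_def)
qed

text \<open>Norming functionals of the points of \<open>D\<close> suffice: if all of them vanish at
  \<open>y\<close>, a point \<open>d\<close> close to \<open>y\<close> satisfies
  \<open>norm d \<le> dist d y\<close>, which is impossible when
  \<open>dist d y < norm y / 2\<close>.\<close>

lemma countable_separating_functionals:
  fixes D :: "'a::real_normed_vector set"
  assumes "countable D" and "D \<noteq> {}"
  shows "\<exists>f :: nat \<Rightarrow> 'a \<Rightarrow>\<^sub>L real. \<forall>y\<in>closure D. (\<forall>k. f k y = 0) \<longrightarrow> y = 0"
proof -
  obtain f :: "'a \<Rightarrow> 'a \<Rightarrow>\<^sub>L real" where f: "\<And>d. f d d = norm d" "\<And>d y. \<bar>f d y\<bar> \<le> norm y"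
    using norming_functional by metis
  have "y = 0" if y: "y \<in> closure D" "\<And>k. f (from_nat_into D k) y = 0" for y
  proof (rule ccontr)
    assume "y \<noteq> 0"
    then obtain d where d: "d \<in> D" "dist d y < norm y / 2"
      using y(1) unfolding closure_approachable by (metis half_gt_zero zero_less_norm_iff)
    then have "f d y = 0" using y(2) from_nat_into_surj[OF assms(1) d(1)] by metis
    then have "norm d \<le> dist d y"
      using f(1)[of d] f(2)[of d "d - y"] by (simp add: blinfun.diff_right dist_norm)
    moreover have "norm y \<le> norm d + dist d y"
      by (metis dist_norm norm_triangle_sub norm_minus_commute)
    ultimately show False using d(2) by simp
  qed
  then show ?thesis by (intro exI[of _ "\<lambda>k. f (from_nat_into D k)"]) blast
qed

lemma bounded_diagonal_subsequence:
  fixes F :: "nat \<Rightarrow> nat \<Rightarrow> real"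
  assumes "\<And>k. bounded (range (F k))"
  shows "\<exists>s :: nat \<Rightarrow> nat. strict_mono s \<and> (\<forall>k. convergent (\<lambda>n. F k (s n)))"
proof -
  interpret subseqs "\<lambda>k s. convergent (\<lambda>n. F k (s n))"
  proof
    fix k and s :: "nat \<Rightarrow> nat"
    have "bounded (range (\<lambda>n. F k (s n)))" by (rule bounded_subset[OF assms[of k]]) auto
    then obtain l r where "strict_mono r" "((\<lambda>n. F k (s n)) \<circ> r) \<longlonglongrightarrow> l"
      using bounded_imp_convergent_subsequence by blast
    then show "\<exists>r. strict_mono r \<and> convergent (\<lambda>n. F k ((s \<circ> r) n))"
      by (auto simp: convergent_def o_def)
  qed
  have "convergent (\<lambda>n. F k (diagseq n))" for k
  proof -
    \<comment> \<open>Only from index \<open>Suc k\<close> on is the diagonal sequence a subsequence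
      of the one selected for \<open>F k\<close>, hence the shift.\<close>
    have "convergent (\<lambda>n. F k ((diagseq \<circ> (+) (Suc k)) n))"
    proof (rule diagseq_holds)
      fix s r :: "nat \<Rightarrow> nat" and k
      assume "strict_mono r" "convergent (\<lambda>n. F k (s n))"
      then show "convergent (\<lambda>n. F k ((s \<circ> r) n))"
        using convergent_subseq_convergent[of "\<lambda>n. F k (s n)" r] by (simp add: o_def)
    qed
    then have "convergent (\<lambda>n. F k (diagseq (n + Suc k)))" by (simp add: o_def add.commute)
    then show ?thesis using convergent_ignore_initial_segment[of "\<lambda>n. F k (diagseq n)" "Suc k"] by simp
  qed
  then show ?thesis using subseq_diagseq by blast
qed

lemma not_tendsto_subseq:
  fixes f :: "nat \<Rightarrow> 'a::metric_space"
  assumes "\<not> f \<longlonglongrightarrow> l"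
  shows "\<exists>e>0. \<exists>s :: nat \<Rightarrow> nat. strict_mono s \<and> (\<forall>n. e \<le> dist (f (s n)) l)"
proof -
  obtain e where e: "e > 0" "\<not> (\<forall>\<^sub>F n in sequentially. dist (f n) l < e)"
    using assms by (auto simp: tendsto_iff)
  then have "infinite {n. e \<le> dist (f n) l}"
    by (simp flip: cofinite_eq_sequentially add: eventually_cofinite not_less)
  then obtain s :: "nat \<Rightarrow> nat" where "strict_mono s" "\<And>n. s n \<in> {n. e \<le> dist (f n) l}"
    using infinite_enumerate by blast
  with e(1) show ?thesis by blast
qed

text \<open>A diagonal subsequence makes countably many separating functionals converge. They
  determine the weak cluster points of all further subsequences, which lie in the separable
  subspace, so there is just one, and every functional converges to its value at it.\<close>

lemma bounded_weakly_convergent_subsequence: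
  fixes X :: "nat \<Rightarrow> 'a::real_normed_vector"
  assumes refl: "reflexive_space TYPE('a)" and X: "bounded (range X)"
  shows "\<exists>(s :: nat \<Rightarrow> nat) l. strict_mono s \<and> weakly_tendsto (X \<circ> s) l"
proof -
  obtain C where "\<forall>x\<in>range X. norm x \<le> C" using X unfolding bounded_iff by (rule exE)
  then have C: "norm (X n) \<le> C" for n by simp
  obtain D where D: "countable D" "D \<noteq> {}" "subspace (closure D)" "range X \<subseteq> D"
    using separable_closed_subspace[of X] by (elim exE conjE)
  obtain f :: "nat \<Rightarrow> 'a \<Rightarrow>\<^sub>L real"
    where f: "\<forall>y\<in>closure D. (\<forall>k. f k y = 0) \<longrightarrow> y = 0"
    using countable_separating_functionals[OF D(1,2)] by (rule exE)
  have bdd: "bounded (range (\<lambda>n. blinfun_apply g (X n)))" for g :: "'a \<Rightarrow>\<^sub>L real"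
  proof -
    have "range (\<lambda>n. blinfun_apply g (X n)) = blinfun_apply g ` range X" by auto
    then show ?thesis using bounded_linear_image[OF X blinfun.bounded_linear_right] by simp
  qed
  have "\<exists>s. strict_mono s \<and> (\<forall>k. convergent (\<lambda>n. f k (X (s n))))"
    by (rule bounded_diagonal_subsequence[of "\<lambda>k n. f k (X n)"]) (rule bdd)
  then obtain s where s: "strict_mono s" "\<forall>k. convergent (\<lambda>n. f k (X (s n)))"
    by (elim exE conjE)
  \<comment> \<open>The functional that measures the distance of \<open>l\<close> to
    \<open>closure D\<close> is zero along the sequence, hence at \<open>l\<close>.\<close>
  have mem: "l \<in> closure D"
    if l: "\<And>(g :: 'a \<Rightarrow>\<^sub>L real) L. (\<lambda>n. g (X (r n))) \<longlonglongrightarrow> L \<Longrightarrow> g l = L" for l and r :: "nat \<Rightarrow> nat"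
  proof -
    obtain g :: "'a \<Rightarrow>\<^sub>L real" where g: "\<And>y. y \<in> closure D \<Longrightarrow> g y = 0" "g l = infdist l (closure D)"
      using functional_infdist[OF D(3)] by blast
    have "(\<lambda>n. blinfun_apply g (X (r n))) = (\<lambda>n. 0)" using g(1) D(4) closure_subset by blast
    then have "(\<lambda>n. blinfun_apply g (X (r n))) \<longlonglongrightarrow> 0" by simp
    then have "infdist l (closure D) = 0" using l g(2) by metis
    then show ?thesis using in_closed_iff_infdist_zero[of "closure D"] D(2) by simp
  qed
  obtain l where l: "\<And>(g :: 'a \<Rightarrow>\<^sub>L real) L. (\<lambda>n. g (X (s n))) \<longlonglongrightarrow> L \<Longrightarrow> g l = L"
    using weak_cluster_point[OF refl, of "\<lambda>n. X (s n)" C] C by blast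
  have "(\<lambda>n. blinfun_apply g ((X \<circ> s) n)) \<longlonglongrightarrow> blinfun_apply g l" for g :: "'a \<Rightarrow>\<^sub>L real"
  proof (rule ccontr)
    assume "\<not> ?thesis"
    then obtain e and r :: "nat \<Rightarrow> nat" where r: "e > 0" "strict_mono r"
      "\<And>n. e \<le> dist (blinfun_apply g ((X \<circ> s) (r n))) (blinfun_apply g l)"
      using not_tendsto_subseq by blast
    have "bounded (range (\<lambda>n. blinfun_apply g (X (s (r n)))))"
      by (rule bounded_subset[OF bdd[of g]]) auto
    then obtain L and r' :: "nat \<Rightarrow> nat" where r': "strict_mono r'" "(\<lambda>n. blinfun_apply g (X (s (r (r' n))))) \<longlonglongrightarrow> L"
      using bounded_imp_convergent_subsequence[of "\<lambda>n. blinfun_apply g (X (s (r n)))"]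
      by (auto simp: o_def)
    obtain l' where l': "\<And>(h :: 'a \<Rightarrow>\<^sub>L real) L. (\<lambda>n. h (X (s (r (r' n))))) \<longlonglongrightarrow> L \<Longrightarrow> h l' = L"
      using weak_cluster_point[OF refl, of "\<lambda>n. X (s (r (r' n)))" C] C by blast
    \<comment> \<open>Both values are the limit of \<open>f k\<close> along \<open>s\<close>, of
      which the new sequence is a subsequence.\<close>
    have "f k l' = f k l" for k
    proof -
      obtain M where M: "(\<lambda>n. f k (X (s n))) \<longlonglongrightarrow> M" using s(2) by (auto simp: convergent_def)
      have "(\<lambda>n. f k (X (s (r (r' n))))) \<longlonglongrightarrow> M"
        using LIMSEQ_subseq_LIMSEQ[OF M strict_mono_o[OF r(2) r'(1)]] by (simp add: o_def)
      with M l l' show ?thesis by metis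
    qed
    moreover have "l \<in> closure D" "l' \<in> closure D" using mem[of s l] l mem[of "\<lambda>n. s (r (r' n))" l'] l' by blast+
    ultimately have "l' - l = 0"
      using f[rule_format, OF subspace_diff[OF D(3)], of l' l] by (simp add: blinfun.diff_right)
    then have "L = g l" using l'[OF r'(2)] by simp
    then have "(\<lambda>n. dist (blinfun_apply g (X (s (r (r' n))))) (blinfun_apply g l)) \<longlonglongrightarrow> 0"
      using tendsto_dist[OF r'(2) tendsto_const[of L]] by simp
    moreover have "e \<le> dist (blinfun_apply g (X (s (r (r' n))))) (blinfun_apply g l)" for n
      using r(3)[of "r' n"] by simp
    ultimately have "e \<le> 0" by (intro LIMSEQ_le_const) auto
    with r(1) show False by simp
  qed
  then have "weakly_tendsto (X \<circ> s) l" by (simp add: weakly_tendsto_def)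
  with s(1) show ?thesis by (intro exI conjI)
qed

section \<open>Ekeland's principle and separation in the plane\<close>

text \<open>The relation \<open>y \<in> G x\<close> is a partial order on \<open>S\<close>. Each
  iterate almost minimizes \<open>f\<close> on the current set \<open>G\<close>, so these sets
  shrink to a single point, which has nothing below it.\<close>

lemma ekeland:
  fixes f :: "'a::metric_space \<Rightarrow> real"
  assumes S: "complete S" and x0: "x0 \<in> S" and e: "e > 0"
    and lower: "\<And>x. x \<in> S \<Longrightarrow> b \<le> f x"
    and lsc: "\<And>x c. x \<in> S \<Longrightarrow> c < f x \<Longrightarrow> \<exists>d>0. \<forall>y\<in>S. dist y x < d \<longrightarrow> c < f y"
  shows "\<exists>x\<in>S. f x \<le> f x0 \<and> (\<forall>y\<in>S. f x \<le> f y + e * dist x y)"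
proof -
  define G where "G x = {y \<in> S. f y + e * dist x y \<le> f x}" for x
  have G_self: "x \<in> G x" if "x \<in> S" for x using that by (simp add: G_def)
  have G_trans: "z \<in> G x" if "y \<in> G x" "z \<in> G y" for x y z
  proof -
    have "e * dist x z \<le> e * dist x y + e * dist y z"
      using mult_left_mono[OF dist_triangle[of x z y], of e] e by (simp add: distrib_left)
    then show ?thesis using that by (simp add: G_def)
  qed
  have bdd: "bdd_below (f ` G x)" for x using lower by (intro bdd_belowI2) (auto simp: G_def)
  have ex: "\<exists>y. y \<in> G x \<and> f y < (INF z\<in>G x. f z) + (1 / 2) ^ n" if "x \<in> S" for x and n :: nat
  proof -
    have "G x \<noteq> {}" using G_self[OF that] by auto
    moreover have "(INF z\<in>G x. f z) < (INF z\<in>G x. f z) + (1 / 2) ^ n" by simp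
    ultimately show ?thesis using cINF_less_iff[OF _ bdd] by blast
  qed
  define next_pt where "next_pt n x = (SOME y. y \<in> G x \<and> f y < (INF z\<in>G x. f z) + (1 / 2) ^ n)"
    for n :: nat and x
  have next_pt: "next_pt n x \<in> G x" "f (next_pt n x) < (INF z\<in>G x. f z) + (1 / 2) ^ n" if "x \<in> S" for x n
    using someI_ex[OF ex[OF that, of n]] by (simp_all add: next_pt_def)
  define X where "X = rec_nat x0 next_pt"
  have X0: "X 0 = x0" and XSuc: "X (Suc n) = next_pt n (X n)" for n by (simp_all add: X_def)
  have XS: "X n \<in> S" for n
  proof (induction n)
    case (Suc n)
    then show ?case using next_pt(1)[OF Suc, of n] by (simp add: XSuc G_def)
  qed (simp add: X0 x0)
  have step: "X (Suc n) \<in> G (X n)" for n using next_pt(1)[OF XS] by (simp add: XSuc)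
  have mem: "X (n + k) \<in> G (X n)" for n k
    by (induction k) (use G_self[OF XS] step G_trans in auto)
  have near_inf: "f (X (Suc n)) < f z + (1 / 2) ^ n" if "z \<in> G (X n)" for z n
    using next_pt(2)[OF XS, of n n] cINF_lower[OF bdd that] by (simp add: XSuc)
  \<comment> \<open>Membership puts \<open>f z + e * dist\<close> below
    \<open>f (X (Suc n))\<close>, which exceeds \<open>f z\<close> by less than
    \<open>(1 / 2) ^ n\<close> because \<open>z\<close> was already a candidate at stage
    \<open>n\<close>.\<close>
  have close: "e * dist (X (Suc n)) z < (1 / 2) ^ n" if "z \<in> G (X (Suc n))" for z n
    using near_inf[OF G_trans[OF step that]] that by (simp add: G_def)
  have close': "dist (X (Suc n)) z < (1 / 2) ^ n / e" if "z \<in> G (X (Suc n))" for z n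
    using close[OF that] e by (simp add: field_simps)
  have "(\<lambda>n. (1 / 2) ^ n / e) \<longlonglongrightarrow> 0 / e"
    by (intro tendsto_divide tendsto_const LIMSEQ_power_zero) (use e in auto)
  then have pow: "(\<lambda>n. (1 / 2) ^ n / e) \<longlonglongrightarrow> 0" by simp
  have conv: "(\<lambda>n. X (Suc n)) \<longlonglongrightarrow> z" if "\<And>n. z \<in> G (X n)" for z
  proof (rule tendsto_dist_iff[THEN iffD2])
    show "(\<lambda>n. dist (X (Suc n)) z) \<longlonglongrightarrow> 0"
      by (intro tendsto_sandwich[OF _ _ tendsto_const pow] always_eventually allI)
        (use close'[OF that] in \<open>auto intro: less_imp_le\<close>)
  qed
  have "Cauchy X"
  proof (rule metric_CauchyI)
    fix d :: real assume "d > 0"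
    then have "\<forall>\<^sub>F n in sequentially. (1 / 2) ^ n / e < d / 2" by (intro order_tendstoD(2)[OF pow]) simp
    then obtain N where N: "(1 / 2) ^ N / e < d / 2" by (auto simp: eventually_sequentially)
    have near: "dist (X (Suc N)) (X n) < d / 2" if "n \<ge> Suc N" for n
      using less_trans[OF close'[OF mem[of "Suc N" "n - Suc N"]] N] that by simp
    have "dist (X i) (X j) < d" if "i \<ge> Suc N" "j \<ge> Suc N" for i j
      using near[OF that(1)] near[OF that(2)] dist_triangle3[of "X i" "X j" "X (Suc N)"] by simp
    then show "\<exists>M. \<forall>m\<ge>M. \<forall>n\<ge>M. dist (X m) (X n) < d" by blast
  qed
  then obtain x where x: "x \<in> S" "X \<longlonglongrightarrow> x" using S XS unfolding complete_def by blast
  \<comment> \<open>Lower semicontinuity enters here: it keeps the limit inside every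
    \<open>G (X n)\<close>.\<close>
  have xG: "x \<in> G (X n)" for n
  proof (rule ccontr)
    assume "x \<notin> G (X n)"
    then have "f (X n) - e * dist (X n) x < f x" using x(1) by (simp add: G_def)
    then obtain c where c: "f (X n) - e * dist (X n) x < c" "c < f x" using dense by blast
    obtain d where d: "d > 0" "\<forall>y\<in>S. dist y x < d \<longrightarrow> c < f y" using lsc[OF x(1) c(2)] by blast
    have lim: "(\<lambda>k. X (n + k)) \<longlonglongrightarrow> x" using LIMSEQ_ignore_initial_segment[OF x(2), of n] by (simp add: add.commute)
    have "\<forall>\<^sub>F k in sequentially. c \<le> f (X n) - e * dist (X n) (X (n + k))"
      using tendstoD[OF lim d(1)]
    proof eventually_elim
      case (elim k)
      then show ?case using d(2) XS[of "n + k"] mem[of n k] by (force simp: G_def)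
    qed
    moreover have "(\<lambda>k. f (X n) - e * dist (X n) (X (n + k))) \<longlonglongrightarrow> f (X n) - e * dist (X n) x"
      by (intro tendsto_intros lim)
    ultimately have "c \<le> f (X n) - e * dist (X n) x"
      by (intro tendsto_lowerbound) auto
    with c(1) show False by simp
  qed
  have "f x \<le> f y + e * dist x y" if y: "y \<in> S" for y
  proof (rule ccontr)
    assume less: "\<not> ?thesis"
    then have "y \<in> G x" using y by (simp add: G_def)
    \<comment> \<open>Now \<open>y\<close> and \<open>x\<close> are both limits of the iterates, so
      they coincide and the strict inequality fails.\<close>
    then have "y \<in> G (X n)" for n using G_trans[OF xG] by blast
    then have "y = x" using conv[of y] conv[OF xG] LIMSEQ_unique by blast
    with less show False by simp
  qed
  moreover have "f x \<le> f x0"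
  proof -
    have "f x + e * dist x0 x \<le> f x0" using xG[of 0] by (simp add: X0 G_def)
    moreover have "0 \<le> e * dist x0 x" using e by simp
    ultimately show ?thesis by linarith
  qed
  ultimately show ?thesis using x(1) by blast
qed

text \<open>The hypothesis keeps the convex image of \<open>B\<close> under \<open>(f, g)\<close>
  out of an open quadrant of the plane. The normal of a separating line has nonnegative entries
  because the quadrant extends to minus infinity in both coordinates; normalised, it gives the
  weights.\<close>

lemma convex_combination_ge:
  fixes f g :: "'a::real_vector \<Rightarrow> real"
  assumes f: "linear f" and g: "linear g" and B: "convex B" "B \<noteq> {}"
    and max: "\<And>h. h \<in> B \<Longrightarrow> \<kappa> \<le> max (f h) (g h)"
  shows "\<exists>\<alpha>\<in>{0..1}. \<forall>h\<in>B. \<kappa> \<le> (1 - \<alpha>) * f h + \<alpha> * g h"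
proof -
  define F where "F h = (f h, g h)" for h
  have "linear F"
    unfolding F_def using linear_add[OF f] linear_add[OF g] linear_scale[OF f] linear_scale[OF g]
    by (intro linearI) auto
  then have convF: "convex (F ` B)" using B(1) convex_linear_image by blast
  have convQ: "convex ({..<\<kappa>} \<times> {..<\<kappa>})" by (intro convex_Times) auto
  have disj: "({..<\<kappa>} \<times> {..<\<kappa>}) \<inter> F ` B = {}" using max by (fastforce simp: F_def)
  have ne: "{..<\<kappa>} \<times> {..<\<kappa>} \<noteq> {}" using lt_ex[of \<kappa>] by auto
  obtain ab b where sep: "ab \<noteq> 0" "\<forall>x\<in>{..<\<kappa>} \<times> {..<\<kappa>}. inner ab x \<le> b" "\<forall>x\<in>F ` B. b \<le> inner ab x"
    using separating_hyperplane_sets[OF convQ convF ne _ disj] B(2) by blast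
  obtain p q where pq: "ab = (p, q)" by force
  have Q: "p * x + q * y \<le> b" if "x < \<kappa>" "y < \<kappa>" for x y using sep(2) that by (auto simp: pq)
  \<comment> \<open>Passes to the closed quadrant. Its corner gives the level
    \<open>(p + q) * \<kappa> \<le> b\<close>, its edges the signs of \<open>p\<close> and
    \<open>q\<close>.\<close>
  have lim: "p * (\<kappa> - s) + q * (\<kappa> - t) \<le> b" if "s \<ge> 0" "t \<ge> 0" for s t
  proof -
    have "(\<lambda>n. p * (\<kappa> - s - inverse (real (Suc n))) + q * (\<kappa> - t - inverse (real (Suc n))))
        \<longlonglongrightarrow> p * (\<kappa> - s - 0) + q * (\<kappa> - t - 0)"
      by (intro tendsto_intros LIMSEQ_inverse_real_of_nat)
    moreover have "p * (\<kappa> - s - inverse (real (Suc n))) + q * (\<kappa> - t - inverse (real (Suc n))) \<le> b" for n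
    proof -
      have "inverse (real (Suc n)) > 0" by simp
      then show ?thesis using that by (intro Q) linarith+
    qed
    ultimately show ?thesis using LIMSEQ_le_const2 by fastforce
  qed
  have unbounded: "0 \<le> x" if "\<And>s. s \<ge> 0 \<Longrightarrow> y - x * s \<le> b" for x y :: real
  proof (rule ccontr)
    assume "\<not> 0 \<le> x"
    then have "x < 0" by simp
    define s where "s = (\<bar>b - y\<bar> + 1) / (- x)"
    have "s \<ge> 0" "- x * s = \<bar>b - y\<bar> + 1" using \<open>x < 0\<close>
      by (auto simp: s_def intro!: divide_nonneg_neg)
    with that[of s] show False by linarith
  qed
  have p: "0 \<le> p" by (rule unbounded[of "(p + q) * \<kappa>"]) (use lim[of _ 0] in \<open>simp add: algebra_simps\<close>)
  have q: "0 \<le> q" by (rule unbounded[of "(p + q) * \<kappa>"]) (use lim[of 0] in \<open>simp add: algebra_simps\<close>)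
  have pos: "p + q > 0" using p q sep(1) by (auto simp: pq zero_prod_def)
  have "\<kappa> \<le> (1 - q / (p + q)) * f h + q / (p + q) * g h" if "h \<in> B" for h
  proof -
    have "(p + q) * \<kappa> \<le> b" using lim[of 0 0] by (simp add: algebra_simps)
    also have "b \<le> p * f h + q * g h" using sep(3) that by (auto simp: F_def pq)
    finally have "\<kappa> \<le> (p * f h + q * g h) / (p + q)" using pos by (simp add: field_simps)
    also have "\<dots> = p / (p + q) * f h + q / (p + q) * g h" by (simp add: add_divide_distrib)
    also have "p / (p + q) = 1 - q / (p + q)" using pos by (simp add: field_simps)
    finally show ?thesis .
  qed
  moreover have "q / (p + q) \<in> {0..1}" using p q pos by simp
  ultimately show ?thesis by blast
qed

section \<open>The reduced functional\<close>

context
  fixes P T :: "'a::real_normed_vector set"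
  assumes ds: "topological_direct_sum P T"
begin

lemma subspace_P: "subspace P" and subspace_T: "subspace T"
  using ds by (auto simp: topological_direct_sum_def)

lemma plus_part_eqI:
  assumes "v \<in> P" "u - v \<in> T"
  shows "plus_part P T u = v"
  unfolding plus_part_def
proof (rule the_equality)
  fix w assume w: "w \<in> P \<and> u - w \<in> T"
  have "v - w \<in> P" using w assms subspace_diff[OF subspace_P] by blast
  moreover have "v - w \<in> T" using w assms subspace_diff[OF subspace_T, of "u - w" "u - v"] by simp
  ultimately have "v - w \<in> P \<inter> T" by blast
  moreover have "P \<inter> T = {0}" using ds by (simp add: topological_direct_sum_def)
  ultimately show "w = v" by auto
qed (use assms in simp)

lemma plus_part_in: "plus_part P T u \<in> P" and tilde_part_in: "tilde_part P T u \<in> T"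
proof -
  obtain v w where "v \<in> P" "w \<in> T" "u = v + w" using ds unfolding topological_direct_sum_def by blast
  moreover from this have "plus_part P T u = v" by (intro plus_part_eqI) simp_all
  ultimately show "plus_part P T u \<in> P" "tilde_part P T u \<in> T" by (auto simp: tilde_part_def)
qed

lemma diff_plus_part_in: "u - plus_part P T u \<in> T"
  using tilde_part_in by (simp add: tilde_part_def)

lemma plus_part_P: "u \<in> P \<Longrightarrow> plus_part P T u = u"
  by (intro plus_part_eqI) (simp_all add: subspace_0[OF subspace_T])

lemma plus_part_T: "u \<in> T \<Longrightarrow> plus_part P T u = 0"
  by (intro plus_part_eqI) (simp_all add: subspace_0[OF subspace_P])

lemma plus_part_add: "plus_part P T (u + v) = plus_part P T u + plus_part P T v"
  using plus_part_in diff_plus_part_in subspace_add[OF subspace_T diff_plus_part_in diff_plus_part_in, of u v]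
  by (intro plus_part_eqI) (auto intro: subspace_add[OF subspace_P] simp: algebra_simps)

lemma plus_part_scaleR: "plus_part P T (c *\<^sub>R u) = c *\<^sub>R plus_part P T u"
  using subspace_scale[OF subspace_T diff_plus_part_in, of c u] plus_part_in
  by (intro plus_part_eqI) (auto intro: subspace_scale[OF subspace_P] simp: algebra_simps)

lemma plus_part_eq_0_iff: "plus_part P T u = 0 \<longleftrightarrow> u \<in> T"
  using plus_part_T diff_plus_part_in[of u] by auto

end

lemma frechet_derivative_eq_blinfun:
  assumes "(f has_derivative blinfun_apply D) (at x)"
  shows "frechet_derivative f (at x) = blinfun_apply D"
  using frechet_derivative_at[OF assms] by simp

lemma has_derivative_line:
  fixes f :: "'a::real_normed_vector \<Rightarrow> real"
  assumes "(f has_derivative f') (at (x + s *\<^sub>R h) within S)" "\<And>s. x + s *\<^sub>R h \<in> S"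
  shows "((\<lambda>s. f (x + s *\<^sub>R h)) has_real_derivative f' h) (at s)"
proof -
  have "((\<lambda>s. x + s *\<^sub>R h) has_derivative (\<lambda>t. t *\<^sub>R h)) (at s)"
    by (auto intro!: derivative_eq_intros)
  moreover have "range (\<lambda>s. x + s *\<^sub>R h) \<subseteq> S" using assms(2) by auto
  then have "(f has_derivative f') (at (x + s *\<^sub>R h) within range (\<lambda>s. x + s *\<^sub>R h))"
    using assms(1) has_derivative_subset by blast
  ultimately have "((\<lambda>s. f (x + s *\<^sub>R h)) has_derivative (\<lambda>t. f' (t *\<^sub>R h))) (at s)"
    by (rule has_derivative_in_compose)
  moreover have "f' (t *\<^sub>R h) = f' h * t" for t
    using linear_scale[OF has_derivative_linear[OF assms(1)], of t h] by simp
  ultimately show ?thesis by (simp add: has_field_derivative_def)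
qed

locale strong_lsc_functional =
  fixes P T :: "'a::banach set" and I :: "'a \<Rightarrow> real"
  assumes reflexive: "reflexive_space TYPE('a)"
    and direct_sum: "topological_direct_sum P T"
    and norm_split: "\<And>u. (norm u)\<^sup>2 = (norm (plus_part P T u))\<^sup>2 + (norm (tilde_part P T u))\<^sup>2"
    and J_C1: "C1_functional (J_fun P T I)"
    and I_C1: "C1_functional I" and I_ge_0: "\<And>u. I u \<ge> 0" and I_0: "I 0 = 0"
    and I2: "\<And>U u. T_tendsto P T U u \<Longrightarrow> liminf (\<lambda>n. ereal (I (U n))) \<ge> ereal (I u)"
    and I3: "\<And>U u. T_tendsto P T U u \<Longrightarrow> (\<lambda>n. I (U n)) \<longlonglongrightarrow> I u \<Longrightarrow> U \<longlonglongrightarrow> u"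
    and I4: "filterlim (\<lambda>u. norm (plus_part P T u) + I u) at_top at_infinity"
    and I5: "\<And>u v. u \<in> M_set P T I \<Longrightarrow> v \<in> T - {0} \<Longrightarrow> I u < I (u + v)"
begin

abbreviation pp where "pp \<equiv> plus_part P T"
abbreviation J where "J \<equiv> J_fun P T I"
abbreviation m where "m \<equiv> m_map P T I"
abbreviation \<Phi> where "\<Phi> \<equiv> Jtilde P T I"

lemmas subspaces = subspace_P[OF direct_sum] subspace_T[OF direct_sum]
lemmas pp_in = plus_part_in[OF direct_sum]
lemmas pp_diff = diff_plus_part_in[OF direct_sum]
lemmas pp_simps [simp] = plus_part_P[OF direct_sum] plus_part_T[OF direct_sum]
  plus_part_add[OF direct_sum] plus_part_scaleR[OF direct_sum] plus_part_in[OF direct_sum]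

lemma P_add: "u \<in> P \<Longrightarrow> v \<in> P \<Longrightarrow> u + v \<in> P" and P_scale: "u \<in> P \<Longrightarrow> c *\<^sub>R u \<in> P"
  and zero_P: "0 \<in> P" and P_diff: "u \<in> P \<Longrightarrow> v \<in> P \<Longrightarrow> u - v \<in> P"
  and T_add: "u \<in> T \<Longrightarrow> v \<in> T \<Longrightarrow> u + v \<in> T" and T_scale: "u \<in> T \<Longrightarrow> c *\<^sub>R u \<in> T"
  and T_diff: "u \<in> T \<Longrightarrow> v \<in> T \<Longrightarrow> u - v \<in> T" and zero_T: "0 \<in> T"
  using subspaces by (auto simp: subspace_add subspace_scale subspace_0 subspace_diff)

lemma pp_minus [simp]: "pp (- u) = - pp u" and pp_subtract [simp]: "pp (u - v) = pp u - pp v"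
proof -
  show *: "pp (- u) = - pp u" for u using plus_part_scaleR[OF direct_sum, of "-1" u] by simp
  show "pp (u - v) = pp u - pp v" using plus_part_add[OF direct_sum, of u "- v"] *[of v] by simp
qed

lemma tilde_eq: "tilde_part P T u = u - pp u" by (simp add: tilde_part_def)

lemma norm_pp_le: "norm (pp u) \<le> norm u"
proof -
  have "(norm (pp u))\<^sup>2 \<le> (norm u)\<^sup>2" using norm_split[of u] by simp
  then show ?thesis by (simp add: power2_le_iff_abs_le)
qed

lemma bounded_linear_pp: "bounded_linear pp"
  by (rule bounded_linear_intro[where K = 1]) (auto simp: norm_pp_le)

lemma J_eq: "J u = 1 / 2 * (norm (pp u))\<^sup>2 - I u" by (simp add: J_fun_def)

text \<open>A chosen derivative with values in the space of bounded functionals, so that its norm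
  continuity can be used.\<close>

definition DJ where
  "DJ = (SOME F' :: 'a \<Rightarrow> 'a \<Rightarrow>\<^sub>L real.
     (\<forall>u. (J has_derivative blinfun_apply (F' u)) (at u)) \<and> continuous_on UNIV F')"

definition DI where
  "DI = (SOME F' :: 'a \<Rightarrow> 'a \<Rightarrow>\<^sub>L real.
     (\<forall>u. (I has_derivative blinfun_apply (F' u)) (at u)) \<and> continuous_on UNIV F')"

lemma DJ: "(J has_derivative blinfun_apply (DJ u)) (at u)" and DJ_cont: "continuous_on UNIV DJ"
  using someI_ex[OF J_C1[unfolded C1_functional_def], folded DJ_def] by auto

lemma DI: "(I has_derivative blinfun_apply (DI u)) (at u)"
  using someI_ex[OF I_C1[unfolded C1_functional_def], folded DI_def] by auto

lemma I_cont: "continuous_on UNIV I" and J_cont: "continuous_on UNIV J"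
  using DI DJ by (auto intro!: continuous_at_imp_continuous_on has_derivative_continuous)

lemma M_iff: "u \<in> M_set P T I \<longleftrightarrow> (\<forall>v\<in>T. DJ u v = 0)"
  by (simp add: M_set_def frechet_derivative_eq_blinfun[OF DJ])

lemma N_iff: "u \<in> N_set P T I \<longleftrightarrow> u \<notin> T \<and> DJ u u = 0 \<and> u \<in> M_set P T I"
proof
  assume "u \<in> N_set P T I"
  then have N: "u \<notin> T" "\<And>s v. v \<in> T \<Longrightarrow> DJ u (s *\<^sub>R u + v) = 0"
    by (auto simp: N_set_def frechet_derivative_eq_blinfun[OF DJ])
  have "DJ u u = 0" using N(2)[of 0 1] zero_T by simp
  moreover have "DJ u v = 0" if "v \<in> T" for v using N(2)[OF that, of 0] by simp
  ultimately show "u \<notin> T \<and> DJ u u = 0 \<and> u \<in> M_set P T I" using N(1) by (simp add: M_iff)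
qed (auto simp: N_set_def frechet_derivative_eq_blinfun[OF DJ] M_iff blinfun.add_right blinfun.scaleR_right)

lemma DJ_line: "((\<lambda>s. J (u + s *\<^sub>R v)) has_real_derivative DJ (u + s *\<^sub>R v) v) (at s)"
  by (rule has_derivative_line[where S = UNIV]) (use DJ in auto)

lemma DI_line: "((\<lambda>s. I (u + s *\<^sub>R v)) has_real_derivative DI (u + s *\<^sub>R v) v) (at s)"
  by (rule has_derivative_line[where S = UNIV]) (use DI in auto)

lemma DJ_T:
  assumes "v \<in> T"
  shows "DJ u v = - DI u v"
proof -
  have "((\<lambda>s. J (u + s *\<^sub>R v)) has_real_derivative DJ u v) (at 0)"
    using DJ_line[of u v 0] by simp
  moreover have "((\<lambda>s. 1 / 2 * (norm (pp u))\<^sup>2 - I (u + s *\<^sub>R v)) has_real_derivative 0 - DI u v) (at 0)"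
    by (intro DERIV_diff DERIV_const) (use DI_line[of u v 0] in simp)
  then have "((\<lambda>s. J (u + s *\<^sub>R v)) has_real_derivative - DI u v) (at 0)"
    using assms by (simp add: J_eq)
  ultimately show ?thesis by (rule DERIV_unique)
qed

text \<open>The quadratic part of \<open>J\<close> is homogeneous of degree 2 along the ray. On the
  Nehari set this yields \<open>DI u u = (norm (pp u))\<^sup>2\<close>, through which (I8) becomes a
  statement about \<open>J\<close>.\<close>

lemma DJ_radial: "DJ u u = (norm (pp u))\<^sup>2 - DI u u"
proof -
  have "((\<lambda>s. J (0 + s *\<^sub>R u)) has_real_derivative DJ u u) (at 1)"
    using DJ_line[of 0 u 1] by simp
  moreover have "((\<lambda>s. 1 / 2 * (norm (pp u))\<^sup>2 * s\<^sup>2 - I (0 + s *\<^sub>R u)) has_real_derivative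
      (norm (pp u))\<^sup>2 - DI u u) (at 1)"
    by (rule DERIV_diff) (auto intro!: derivative_eq_intros simp: DI_line[of 0 u 1, simplified])
  then have "((\<lambda>s. J (0 + s *\<^sub>R u)) has_real_derivative (norm (pp u))\<^sup>2 - DI u u) (at 1)"
    by (simp add: J_eq power_mult_distrib mult.commute)
  ultimately show ?thesis by (rule DERIV_unique)
qed

lemma coercive:
  obtains R where "\<And>u. norm (pp u) + I u \<le> C \<Longrightarrow> norm u \<le> R"
proof -
  have "eventually (\<lambda>u. C + 1 \<le> norm (pp u) + I u) at_infinity"
    using I4 by (simp add: filterlim_at_top)
  then obtain R where "\<And>u. R \<le> norm u \<Longrightarrow> C + 1 \<le> norm (pp u) + I u"
    by (auto simp: eventually_at_infinity)
  then have "norm u \<le> R" if "norm (pp u) + I u \<le> C" for u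
    using that by (metis add.commute add_le_same_cancel1 linear not_one_le_zero order_trans)
  then show thesis by (rule that)
qed

section \<open>Minimization on the fibres and the map \<open>m\<close>\<close>

text \<open>(I4) turns bounds on positive part and \<open>I\<close> into a norm bound, so
  reflexivity applies. Only the \<open>T\<close>-component is taken from the weak limit; the
  positive part converges in norm by assumption.\<close>

lemma T_convergent_subsequence:
  assumes U: "(\<lambda>n. pp (U n)) \<longlonglongrightarrow> p" and p: "p \<in> P" and C: "\<And>n. I (U n) \<le> C"
  shows "\<exists>(s :: nat \<Rightarrow> nat) v. strict_mono s \<and> v \<in> T \<and> T_tendsto P T (U \<circ> s) (p + v)"
proof -
  have "bounded (range (\<lambda>n. pp (U n)))" using U convergent_imp_bounded by blast
  then obtain B where B: "\<forall>x\<in>range (\<lambda>n. pp (U n)). norm x \<le> B" unfolding bounded_iff by (rule exE)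
  obtain R where R: "\<And>u. norm (pp u) + I u \<le> B + C \<Longrightarrow> norm u \<le> R" using coercive by blast
  have "norm (U n) \<le> R" for n by (rule R) (use B C[of n] in \<open>auto intro!: add_mono\<close>)
  then have "bounded (range U)" unfolding bounded_iff by (intro exI[of _ R]) auto
  then obtain s :: "nat \<Rightarrow> nat" and l where s: "strict_mono s" "weakly_tendsto (U \<circ> s) l"
    using bounded_weakly_convergent_subsequence[OF reflexive] by blast
  have "(\<lambda>n. blinfun_apply f (tilde_part P T (U (s n)))) \<longlonglongrightarrow> blinfun_apply f (tilde_part P T l)"
    for f :: "'a \<Rightarrow>\<^sub>L real"
  proof -
    have "bounded_linear (\<lambda>u. u - pp u)"
      by (intro bounded_linear_sub bounded_linear_ident bounded_linear_pp)
    then have "bounded_linear (\<lambda>u. blinfun_apply f (tilde_part P T u))"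
      unfolding tilde_eq by (rule bounded_linear_compose[OF blinfun.bounded_linear_right])
    \<comment> \<open>Composing \<open>f\<close> with the bounded projection onto \<open>T\<close>
      gives a functional on the whole space, to which weak convergence applies.\<close>
    then obtain g :: "'a \<Rightarrow>\<^sub>L real" where g: "blinfun_apply g = (\<lambda>u. blinfun_apply f (tilde_part P T u))"
      using bounded_linear_Blinfun_apply by blast
    have "(\<lambda>n. blinfun_apply g ((U \<circ> s) n)) \<longlonglongrightarrow> blinfun_apply g l"
      using s(2) unfolding weakly_tendsto_def by blast
    then show ?thesis by (simp add: g)
  qed
  moreover have "(\<lambda>n. pp ((U \<circ> s) n)) \<longlonglongrightarrow> p"
    using LIMSEQ_subseq_LIMSEQ[OF U s(1)] by (simp add: o_def)
  moreover have T: "tilde_part P T l \<in> T" using tilde_part_in[OF direct_sum] .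
  ultimately have "T_tendsto P T (U \<circ> s) (p + tilde_part P T l)"
    unfolding T_tendsto_def weakly_tendsto_def using p by (simp add: tilde_eq)
  with s(1) T show ?thesis by blast
qed

lemma I2_bound:
  assumes "T_tendsto P T U u" "\<And>n. I (U n) \<le> b n" "b \<longlonglongrightarrow> l"
  shows "I u \<le> l"
proof -
  have "ereal (I u) \<le> liminf (\<lambda>n. ereal (I (U n)))" by (rule I2[OF assms(1)])
  also have "\<dots> \<le> liminf (\<lambda>n. ereal (b n))"
    by (rule Liminf_mono) (use assms(2) in auto)
  also have "\<dots> = ereal l" using assms(3) by (intro lim_imp_Liminf) auto
  finally show ?thesis by simp
qed

text \<open>The direct method: along a minimizing sequence in \<open>u + T\<close> the positive part
  is constantly \<open>u\<close>, so compactness and (I2) apply.\<close>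

lemma minimizer_exists:
  assumes u: "u \<in> P"
  shows "\<exists>w\<in>T. \<forall>v\<in>T. I (u + w) \<le> I (u + v)"
proof -
  define i where "i = (INF v\<in>T. I (u + v))"
  have ne: "T \<noteq> {}" using zero_T by auto
  have bdd: "bdd_below ((\<lambda>v. I (u + v)) ` T)" using I_ge_0 by (intro bdd_belowI2)
  have lower: "i \<le> I (u + v)" if "v \<in> T" for v
    unfolding i_def by (rule cINF_lower[OF bdd that])
  have "\<exists>v\<in>T. I (u + v) < i + 1 / real (Suc n)" for n
  proof -
    have "(INF v\<in>T. I (u + v)) < i + 1 / real (Suc n)" by (simp add: i_def)
    then show ?thesis using cINF_less_iff[OF ne bdd] by blast
  qed
  then obtain V where V: "\<And>n. V n \<in> T" "\<And>n. I (u + V n) < i + 1 / real (Suc n)" by metis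
  have pp: "pp (u + V n) = u" for n using u V(1) by simp
  have le: "I (u + V n) \<le> i + 1" for n
  proof -
    have "1 / real (Suc n) \<le> 1" by simp
    then show ?thesis using V(2)[of n] by linarith
  qed
  have "(\<lambda>n. pp (u + V n)) \<longlonglongrightarrow> u" using pp by simp
  then obtain s :: "nat \<Rightarrow> nat" and w where s: "strict_mono s" "w \<in> T"
    "T_tendsto P T ((\<lambda>n. u + V n) \<circ> s) (u + w)"
    using T_convergent_subsequence[OF _ u, of "\<lambda>n. u + V n"] le by blast
  have "(\<lambda>n. i + 1 / real (Suc n)) \<longlonglongrightarrow> i + 0"
    using LIMSEQ_inverse_real_of_nat by (intro tendsto_intros) (simp add: inverse_eq_divide)
  then have "(\<lambda>n. i + 1 / real (Suc (s n))) \<longlonglongrightarrow> i"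
    using LIMSEQ_subseq_LIMSEQ[OF _ s(1)] by (fastforce simp: o_def)
  then have "I (u + w) \<le> i"
    using V(2) by (intro I2_bound[OF s(3)]) (auto intro: less_imp_le)
  with s(2) lower show ?thesis by (meson order_trans)
qed

lemma minimizer_in_M:
  assumes w: "\<And>v. v \<in> T \<Longrightarrow> I w \<le> I (w + v)"
  shows "w \<in> M_set P T I"
  unfolding M_iff
proof
  fix v assume v: "v \<in> T"
  have "((\<lambda>s. I (w + s *\<^sub>R v)) has_real_derivative DI w v) (at 0)" using DI_line[of w v 0] by simp
  then have "DI w v = 0"
    by (rule DERIV_local_min[where d = 1]) (use w T_scale[OF v] in auto)
  then show "DJ w v = 0" by (simp add: DJ_T[OF v])
qed

text \<open>By (I5), of two distinct points of \<open>M_set\<close> in one fibre each would have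
  strictly the smaller value of \<open>I\<close>.\<close>

lemma m_unique:
  assumes "w \<in> M_set P T I"
  shows "m (pp w) = w"
  unfolding m_map_def
proof (rule the_equality)
  show "w \<in> M_set P T I \<and> (\<exists>v\<in>T. w = pp w + v)"
    using assms pp_diff[of w] by (auto intro!: bexI[of _ "w - pp w"])
next
  fix w' assume "w' \<in> M_set P T I \<and> (\<exists>v\<in>T. w' = pp w + v)"
  then obtain v where w': "w' \<in> M_set P T I" "v \<in> T" "w' = pp w + v" by blast
  have d: "w' - w \<in> T" "w - w' \<in> T" using T_diff[OF w'(2) pp_diff[of w]] T_diff[OF pp_diff[of w] w'(2)] w'(3)
    by (simp_all add: algebra_simps)
  show "w' = w"
  proof (rule ccontr)
    assume "w' \<noteq> w"
    then show False using I5[OF w'(1), of "w - w'"] I5[OF assms, of "w' - w"] d by simp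
  qed
qed

lemma m:
  assumes "u \<in> P"
  shows m_M: "m u \<in> M_set P T I" and pp_m: "pp (m u) = u"
    and m_min: "pp w = u \<Longrightarrow> I (m u) \<le> I w"
    and m_min_strict: "pp w = u \<Longrightarrow> w \<noteq> m u \<Longrightarrow> I (m u) < I w"
proof -
  obtain w0 where w0: "w0 \<in> T" "\<And>v. v \<in> T \<Longrightarrow> I (u + w0) \<le> I (u + v)"
    using minimizer_exists[OF assms] by blast
  have M: "u + w0 \<in> M_set P T I"
  proof (rule minimizer_in_M)
    fix v assume "v \<in> T"
    then show "I (u + w0) \<le> I (u + w0 + v)" using w0(2)[OF T_add[OF w0(1)], of v] by (simp add: add.assoc)
  qed
  have pp: "pp (u + w0) = u" using assms w0(1) by simp
  have mu: "m u = u + w0" using m_unique[OF M] pp by simp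
  show M': "m u \<in> M_set P T I" "pp (m u) = u" using M mu pp by auto
  show strict: "I (m u) < I w" if "pp w = u" "w \<noteq> m u" for w
  proof -
    have "pp (w - m u) = 0" using that M'(2) by simp
    then have "w - m u \<in> T - {0}" using that plus_part_eq_0_iff[OF direct_sum, of "w - m u"] by simp
    then show ?thesis using I5[OF M'(1), of "w - m u"] by simp
  qed
  show "I (m u) \<le> I w" if "pp w = u" using strict[OF that] by (cases "w = m u") auto
qed

text \<open>On a fibre the quadratic part of \<open>J\<close> is constant, so minimizing
  \<open>I\<close> there is maximizing \<open>J\<close>.\<close>

lemma J_le_Phi: "J w \<le> \<Phi> (pp w)"
  using m_min[OF pp_in, of w w] pp_m[OF pp_in, of w] by (simp add: Jtilde_def J_eq)

text \<open>A limit of the minimizers has value at most \<open>I (m u)\<close> and lies in the fibre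
  of \<open>u\<close>, so it is \<open>m u\<close> by strictness. The values of \<open>I\<close>
  then converge as well, and (I3) gives norm convergence.\<close>

lemma m_sequentially:
  assumes U: "\<And>n. U n \<in> P" "U \<longlonglongrightarrow> u" and u: "u \<in> P"
  shows "(\<lambda>n. m (U n)) \<longlonglongrightarrow> m u"
proof (rule ccontr)
  assume "\<not> ?thesis"
  then obtain e and s :: "nat \<Rightarrow> nat" where s: "e > 0" "strict_mono s"
    "\<And>n. e \<le> dist (m (U (s n))) (m u)"
    using not_tendsto_subseq by blast
  define V where "V n = m (U (s n))" for n
  have ppV: "pp (V n) = U (s n)" for n by (simp add: V_def pp_m U(1))
  have lim: "(\<lambda>n. U (s n)) \<longlonglongrightarrow> u" using LIMSEQ_subseq_LIMSEQ[OF U(2) s(2)] by (simp add: o_def)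
  \<comment> \<open>The competitor translates the minimizer over \<open>u\<close> into the fibre
    over \<open>U (s n)\<close>; its value tends to \<open>I (m u)\<close>.\<close>
  define b where "b n = I (U (s n) + (m u - u))" for n
  have T: "m u - u \<in> T" using pp_diff[of "m u"] pp_m[OF u] by simp
  have Ib: "I (V n) \<le> b n" for n unfolding V_def b_def
    by (rule m_min) (use U(1) T u in \<open>simp_all add: pp_m\<close>)
  have "(\<lambda>n. U (s n) + (m u - u)) \<longlonglongrightarrow> u + (m u - u)" by (intro tendsto_intros lim)
  then have "b \<longlonglongrightarrow> I (u + (m u - u))" unfolding b_def
    by (rule continuous_on_tendsto_compose[OF I_cont]) auto
  then have blim: "b \<longlonglongrightarrow> I (m u)" by simp
  then have "bounded (range b)" using convergent_imp_bounded by blast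
  then obtain C where C: "\<forall>x\<in>range b. norm x \<le> C" unfolding bounded_iff by (rule exE)
  have VC: "I (V n) \<le> C" for n using Ib[of n] C by (auto simp: abs_le_iff intro: order_trans)
  have "(\<lambda>n. pp (V n)) \<longlonglongrightarrow> u" using lim ppV by simp
  then obtain q :: "nat \<Rightarrow> nat" and v where q: "strict_mono q" "v \<in> T" "T_tendsto P T (V \<circ> q) (u + v)"
    using T_convergent_subsequence[of V, OF _ u VC] by blast
  have bq: "(\<lambda>n. b (q n)) \<longlonglongrightarrow> I (m u)" using LIMSEQ_subseq_LIMSEQ[OF blim q(1)] by (simp add: o_def)
  have "I (u + v) \<le> I (m u)" using Ib by (intro I2_bound[OF q(3) _ bq]) simp
  moreover have "pp (u + v) = u" using u q(2) by simp
  ultimately have uv: "u + v = m u" using m_min_strict[OF u, of "u + v"] by force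
  have low: "ereal (I (m u)) \<le> liminf (\<lambda>n. ereal (I ((V \<circ> q) n)))"
    using I2[OF q(3)] uv by simp
  have up: "limsup (\<lambda>n. ereal (I ((V \<circ> q) n))) \<le> ereal (I (m u))"
  proof -
    have "limsup (\<lambda>n. ereal (I ((V \<circ> q) n))) \<le> limsup (\<lambda>n. ereal (b (q n)))"
      by (rule Limsup_mono) (use Ib in auto)
    also have "\<dots> = ereal (I (m u))" using bq by (intro lim_imp_Limsup) auto
    finally show ?thesis .
  qed
  have "(\<lambda>n. I ((V \<circ> q) n)) \<longlonglongrightarrow> I (m u)"
    by (rule limsup_le_liminf_real[OF up low])
  then have "(\<lambda>n. I ((V \<circ> q) n)) \<longlonglongrightarrow> I (u + v)" using uv by simp
  then have "(V \<circ> q) \<longlonglongrightarrow> m u" using I3[OF q(3)] uv by simp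
  then have "\<forall>\<^sub>F n in sequentially. dist ((V \<circ> q) n) (m u) < e" using s(1) by (rule tendstoD)
  then obtain n where "dist ((V \<circ> q) n) (m u) < e" using eventually_happens by fastforce
  with s(3)[of "q n"] show False by (simp add: V_def)
qed

lemma m_cont: "continuous_on P m"
  unfolding continuous_on_sequentially using m_sequentially by (auto simp: o_def)

section \<open>Differentiability of the reduced functional\<close>

lemma Phi_cont: "continuous_on P \<Phi>"
proof -
  have "continuous_on P (\<lambda>u. J (m u))"
    by (rule continuous_on_compose2[OF J_cont m_cont]) auto
  then show ?thesis by (simp add: Jtilde_def)
qed

lemma DPhi_cont: "continuous_on P (\<lambda>u. DJ (m u))"
  by (rule continuous_on_compose2[OF DJ_cont m_cont]) auto

lemma J_mean_value: "\<exists>\<theta>\<in>{0<..<1}. J (x + h) - J x = DJ (x + \<theta> *\<^sub>R h) h"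
proof -
  have "\<exists>z. z > 0 \<and> z < 1 \<and> J (x + 1 *\<^sub>R h) - J (x + 0 *\<^sub>R h) = (1 - 0) * DJ (x + z *\<^sub>R h) h"
    by (rule MVT2) (use DJ_line in auto)
  then show ?thesis by auto
qed

text \<open>Since \<open>m u\<close> maximizes \<open>J\<close> on \<open>u + T\<close>, the increment of \<open>\<Phi>\<close> lies between
  \<open>J (m u + h) - J (m u)\<close> and \<open>J (m (u + h)) - J (m (u + h) - h)\<close>.\<close>

lemma Phi_deriv:
  assumes u: "u \<in> P"
  shows "(\<Phi> has_derivative blinfun_apply (DJ (m u))) (at u within P)"
  unfolding has_derivative_within_alt
proof (intro conjI allI impI)
  show "bounded_linear (blinfun_apply (DJ (m u)))" by (rule blinfun.bounded_linear_right)
next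
  fix e :: real assume "e > 0"
  have "isCont DJ (m u)" using DJ_cont by (simp add: continuous_on_eq_continuous_at)
  then obtain d where d: "d > 0" "\<And>w. dist w (m u) < d \<Longrightarrow> dist (DJ w) (DJ (m u)) < e"
    using \<open>e > 0\<close> unfolding continuous_at_eps_delta by blast
  obtain d' where d': "d' > 0" "\<And>y. y \<in> P \<Longrightarrow> dist y u < d' \<Longrightarrow> dist (m y) (m u) < d / 2"
    using m_cont u d(1) unfolding continuous_on_iff by (metis half_gt_zero)
  have close: "\<bar>DJ w h - DJ (m u) h\<bar> \<le> e * norm h" if "dist w (m u) < d" for w h
  proof -
    have "\<bar>DJ w h - DJ (m u) h\<bar> \<le> norm (DJ w - DJ (m u)) * norm h"
      using norm_blinfun[of "DJ w - DJ (m u)" h] by (simp add: blinfun.diff_left)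
    also have "\<dots> \<le> e * norm h"
      using d(2)[OF that] by (intro mult_right_mono) (auto simp: dist_norm)
    finally show ?thesis .
  qed
  show "\<exists>d>0. \<forall>y\<in>P. norm (y - u) < d \<longrightarrow>
      norm (\<Phi> y - \<Phi> u - blinfun_apply (DJ (m u)) (y - u)) \<le> e * norm (y - u)"
  proof (intro exI[of _ "min d' (d / 2)"] conjI ballI impI)
    show "0 < min d' (d / 2)" using d d' by simp
    fix y assume y: "y \<in> P" "norm (y - u) < min d' (d / 2)"
    define h where "h = y - u"
    have h: "pp h = h" "norm h < d / 2" "dist y u < d'" using y u by (auto simp: h_def dist_norm P_diff)
    have small: "norm (\<theta> *\<^sub>R h) < d / 2" if "\<theta> \<in> {0<..<1}" for \<theta>
    proof -
      have "norm (\<theta> *\<^sub>R h) \<le> 1 * norm h" using that unfolding norm_scaleR by (intro mult_right_mono) auto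
      with h(2) show ?thesis by simp
    qed
    obtain \<theta> where \<theta>: "\<theta> \<in> {0<..<1}" "J (m u + h) - J (m u) = DJ (m u + \<theta> *\<^sub>R h) h"
      using J_mean_value by blast
    have "pp (m u + h) = y" using h(1) pp_m[OF u] by (simp add: h_def)
    then have "J (m u + h) \<le> \<Phi> y" using J_le_Phi[of "m u + h"] by simp
    then have "DJ (m u + \<theta> *\<^sub>R h) h \<le> \<Phi> y - \<Phi> u" using \<theta>(2) by (simp add: Jtilde_def)
    moreover have "dist (m u + \<theta> *\<^sub>R h) (m u) < d" using small[OF \<theta>(1)] d(1) by (simp add: dist_norm)
    ultimately have lo: "- (e * norm h) \<le> \<Phi> y - \<Phi> u - DJ (m u) h"
      using close[of "m u + \<theta> *\<^sub>R h" h] by linarith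
    obtain \<eta> where \<eta>: "\<eta> \<in> {0<..<1}" "J (m y - h + h) - J (m y - h) = DJ (m y - h + \<eta> *\<^sub>R h) h"
      using J_mean_value by blast
    have "pp (m y - h) = u" using h(1) pp_m[OF y(1)] by (simp add: h_def)
    then have "J (m y - h) \<le> \<Phi> u" using J_le_Phi[of "m y - h"] by simp
    then have "\<Phi> y - \<Phi> u \<le> DJ (m y - h + \<eta> *\<^sub>R h) h" using \<eta>(2) by (simp add: Jtilde_def)
    moreover have "dist (m y - h + \<eta> *\<^sub>R h) (m u) < d"
    proof -
      \<comment> \<open>The intermediate point differs from \<open>m u\<close> by a change of base
        point and a part of \<open>h\<close>; each costs less than \<open>d / 2\<close>.\<close>
      have "m y - h + \<eta> *\<^sub>R h - m u = (m y - m u) - (1 - \<eta>) *\<^sub>R h" by (simp add: algebra_simps)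
      then have "dist (m y - h + \<eta> *\<^sub>R h) (m u) \<le> dist (m y) (m u) + norm ((1 - \<eta>) *\<^sub>R h)"
        using norm_triangle_ineq4[of "m y - m u" "(1 - \<eta>) *\<^sub>R h"] by (simp only: dist_norm)
      moreover have "norm ((1 - \<eta>) *\<^sub>R h) < d / 2" by (rule small) (use \<eta>(1) in auto)
      ultimately show ?thesis using d'(2)[OF y(1) h(3)] by simp
    qed
    ultimately have "\<Phi> y - \<Phi> u - DJ (m u) h \<le> e * norm h"
      using close[of "m y - h + \<eta> *\<^sub>R h" h] by linarith
    with lo show "norm (\<Phi> y - \<Phi> u - blinfun_apply (DJ (m u)) (y - u)) \<le> e * norm (y - u)"
      by (simp add: h_def abs_le_iff)
  qed
qed

lemma Phi_line:
  assumes "x \<in> P" "h \<in> P"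
  shows "((\<lambda>s. \<Phi> (x + s *\<^sub>R h)) has_real_derivative DJ (m (x + s *\<^sub>R h)) h) (at s)"
  by (rule has_derivative_line[OF Phi_deriv]) (use assms in \<open>auto intro: P_add P_scale\<close>)

lemma Phi_0: "\<Phi> 0 = 0" and m_0: "m 0 = 0"
proof -
  have "0 \<in> M_set P T I" by (rule minimizer_in_M) (simp add: I_0 I_ge_0)
  from m_unique[OF this] show "m 0 = 0" by (simp add: zero_P)
  then show "\<Phi> 0 = 0" by (simp add: Jtilde_def J_eq zero_P I_0)
qed

end

section \<open>Rays and the Nehari set\<close>

locale mountain_pass_functional = strong_lsc_functional +
  fixes r a :: real
  assumes r_pos: "r > 0" and a_pos: "a > 0"
    and I6: "(INF u\<in>{u\<in>P. norm u = r}. ereal (J_fun P T I u)) = ereal a"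
    and I7: "\<And>(t :: nat \<Rightarrow> real) U u.
        filterlim t at_top sequentially \<Longrightarrow>
        (\<lambda>n. plus_part P T (U n)) \<longlonglongrightarrow> plus_part P T u \<Longrightarrow> plus_part P T u \<noteq> 0 \<Longrightarrow>
        filterlim (\<lambda>n. I (t n *\<^sub>R U n) / (t n)\<^sup>2) at_top sequentially"
    and I8: "\<And>u t v. u \<in> N_set P T I \<Longrightarrow> t \<ge> 0 \<Longrightarrow> v \<in> T \<Longrightarrow>
        (t\<^sup>2 - 1) / 2 * frechet_derivative I (at u) u + I u - I (t *\<^sub>R u + v) \<le> 0"
begin

text \<open>An infimum over the empty set would be infinite in \<open>ereal\<close>, whereas (I6)
  says that it is the real number \<open>a\<close>.\<close>

lemma sphere_nonempty: obtains v where "v \<in> P" "norm v = r"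
proof -
  have "{u \<in> P. norm u = r} \<noteq> {}"
  proof
    assume empty: "{u \<in> P. norm u = r} = {}"
    show False using I6 unfolding empty by (simp add: top_ereal_def)
  qed
  then show thesis using that by blast
qed

lemma sphere_bound:
  assumes "u \<in> P" "norm u = r"
  shows "a \<le> \<Phi> u"
proof -
  have "(INF u\<in>{u\<in>P. norm u = r}. ereal (J u)) \<le> ereal (J u)"
    by (rule INF_lower) (use assms in simp)
  then have "a \<le> J u" unfolding I6 by simp
  also have "\<dots> \<le> \<Phi> u" using J_le_Phi[of u] assms(1) by simp
  finally show ?thesis .
qed

lemma ray_sphere_bound:
  assumes "u \<in> P" "u \<noteq> 0"
  shows "a \<le> \<Phi> ((r / norm u) *\<^sub>R u)"
  by (rule sphere_bound) (use assms r_pos in \<open>auto intro: P_scale\<close>)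

text \<open>For \<open>u\<close> in the Nehari set \<open>DI u u\<close> is the squared norm of
  \<open>pp u\<close>, so the first term of (I8) is exactly the difference of the quadratic parts of
  \<open>J\<close> at \<open>w\<close> and at \<open>u\<close>.\<close>

lemma N_maximal:
  assumes u: "u \<in> N_set P T I" and s: "s \<ge> 0" and w: "pp w = s *\<^sub>R pp u"
  shows "J w \<le> J u"
proof -
  have "pp (w - s *\<^sub>R u) = 0" using w by simp
  then have "w - s *\<^sub>R u \<in> T" using plus_part_eq_0_iff[OF direct_sum] by blast
  from I8[OF u s this]
  have "(s\<^sup>2 - 1) / 2 * DI u u + I u - I w \<le> 0" by (simp add: frechet_derivative_eq_blinfun[OF DI])
  moreover have "DI u u = (norm (pp u))\<^sup>2" using u DJ_radial[of u] by (simp add: N_iff)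
  ultimately show ?thesis using w by (simp add: J_eq power_mult_distrib field_simps)
qed

lemma N_E:
  assumes "u \<in> N_set P T I"
  shows "m (pp u) = u" "pp u \<noteq> 0" "\<Phi> (pp u) = J u"
  using assms m_unique[of u] plus_part_eq_0_iff[OF direct_sum, of u] by (auto simp: N_iff Jtilde_def)

text \<open>The vectors \<open>m v\<close> and \<open>v\<close> differ by an element of
  \<open>T\<close>, where the derivative at \<open>m v\<close> vanishes, so being critical along
  \<open>v\<close> is being critical along \<open>m v\<close>.\<close>

lemma critical_N:
  assumes v: "v \<in> P" "v \<noteq> 0" and crit: "DJ (m v) v = 0"
  shows "m v \<in> N_set P T I"
proof -
  have "m v - v \<in> T" using pp_diff[of "m v"] pp_m[OF v(1)] by simp
  then have "DJ (m v) (v + (m v - v)) = 0"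
    using m_M[OF v(1)] crit unfolding blinfun.add_right M_iff by simp
  moreover have "m v \<notin> T" using v pp_m[OF v(1)] plus_part_eq_0_iff[OF direct_sum, of "m v"] by auto
  ultimately show ?thesis using m_M[OF v(1)] by (simp add: N_iff)
qed

lemma critical_ray_maximal:
  assumes v: "v \<in> P" "v \<noteq> 0" and crit: "DJ (m v) v = 0" and "s \<ge> 0"
  shows "\<Phi> (s *\<^sub>R v) \<le> \<Phi> v"
  using N_maximal[OF critical_N[OF v crit] \<open>s \<ge> 0\<close>, of "m (s *\<^sub>R v)"] v(1)
  by (simp add: Jtilde_def pp_m P_scale)

lemma Phi_ray_line:
  assumes "v \<in> P"
  shows "((\<lambda>s. \<Phi> (s *\<^sub>R v)) has_real_derivative DJ (m (s *\<^sub>R v)) v) (at s)"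
  using Phi_line[OF zero_P assms, of s] by simp

lemma Phi_ray_cont: "v \<in> P \<Longrightarrow> continuous_on S (\<lambda>s. \<Phi> (s *\<^sub>R v))"
  by (intro continuous_at_imp_continuous_on ballI DERIV_isCont) (rule Phi_ray_line)

text \<open>An interior minimum on a ray would be critical, hence a global maximum on the ray.\<close>

lemma ray_quasiconcave:
  assumes v: "v \<in> P" and t: "0 \<le> t1" "t1 \<le> t" "t \<le> t2"
  shows "min (\<Phi> (t1 *\<^sub>R v)) (\<Phi> (t2 *\<^sub>R v)) \<le> \<Phi> (t *\<^sub>R v)"
proof (rule ccontr)
  assume "\<not> ?thesis"
  then have less: "\<Phi> (t *\<^sub>R v) < \<Phi> (t1 *\<^sub>R v)" "\<Phi> (t *\<^sub>R v) < \<Phi> (t2 *\<^sub>R v)" by auto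
  then have "v \<noteq> 0" by auto
  obtain t0 where t0: "t0 \<in> {t1..t2}" "\<And>s. s \<in> {t1..t2} \<Longrightarrow> \<Phi> (t0 *\<^sub>R v) \<le> \<Phi> (s *\<^sub>R v)"
    using continuous_attains_inf[OF compact_Icc _ Phi_ray_cont[OF v], of t1 t2] t by force
  have le: "\<Phi> (t0 *\<^sub>R v) \<le> \<Phi> (t *\<^sub>R v)" using t0(2)[of t] t by simp
  have int: "t1 < t0" "t0 < t2" using t0(1) le less by (metis atLeastAtMost_iff leD order_le_less)+
  have "DJ (m (t0 *\<^sub>R v)) v = 0"
    by (rule DERIV_local_min[OF Phi_ray_line[OF v], where d = "min (t0 - t1) (t2 - t0)"])
      (use int in \<open>auto intro!: t0(2)\<close>)
  then have "DJ (m (t0 *\<^sub>R v)) (t0 *\<^sub>R v) = 0" by (simp add: blinfun.scaleR_right)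
  moreover have "t0 *\<^sub>R v \<noteq> 0" using int t(1) \<open>v \<noteq> 0\<close> by simp
  \<comment> \<open>The factor \<open>t1 / t0\<close> leads from the minimum back to the left end,
    where \<open>\<Phi>\<close> is strictly larger.\<close>
  ultimately have "\<Phi> ((t1 / t0) *\<^sub>R t0 *\<^sub>R v) \<le> \<Phi> (t0 *\<^sub>R v)"
    using int t(1) by (intro critical_ray_maximal P_scale v) auto
  then show False using int t(1) le less by simp
qed

text \<open>After division by \<open>(t n)\<^sup>2\<close> the quadratic part stays bounded, while
  (I7) sends the other part to infinity.\<close>

lemma Phi_eventually_neg:
  assumes W: "\<And>n. W n \<in> P" "W \<longlonglongrightarrow> w" and w: "w \<in> P" "w \<noteq> 0"
    and t: "filterlim t at_top sequentially" "\<And>n. t n > 0"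
  shows "\<forall>\<^sub>F n in sequentially. \<Phi> (t n *\<^sub>R W n) < 0"
proof -
  have ppm: "pp (m (t n *\<^sub>R W n)) = t n *\<^sub>R W n" for n by (intro pp_m P_scale W)
  \<comment> \<open>Rescaling \<open>m (t n *\<^sub>R W n)\<close> by \<open>t n\<close> makes the
    positive parts equal to \<open>W n\<close>, whose limit is nonzero, as (I7) requires.\<close>
  define U where "U n = (1 / t n) *\<^sub>R m (t n *\<^sub>R W n)" for n
  have tU: "t n *\<^sub>R U n = m (t n *\<^sub>R W n)" for n using t(2)[of n] by (simp add: U_def)
  have ppU: "pp (U n) = W n" for n unfolding U_def using ppm[of n] t(2)[of n] by simp
  have "filterlim (\<lambda>n. I (t n *\<^sub>R U n) / (t n)\<^sup>2) at_top sequentially"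
    by (rule I7[OF t(1), of U w]) (use W(2) w in \<open>simp_all add: ppU\<close>)
  moreover have "bounded (range W)" using W(2) convergent_imp_bounded by blast
  then obtain B where B: "\<forall>x\<in>range W. norm x \<le> B" unfolding bounded_iff by (rule exE)
  ultimately have "\<forall>\<^sub>F n in sequentially. B\<^sup>2 + 1 \<le> I (t n *\<^sub>R U n) / (t n)\<^sup>2"
    by (simp add: filterlim_at_top)
  then show ?thesis
  proof eventually_elim
    case (elim n)
    have "(norm (W n))\<^sup>2 \<le> B\<^sup>2" using B by (intro power_mono) auto
    then have "(norm (W n))\<^sup>2 < 2 * (I (t n *\<^sub>R U n) / (t n)\<^sup>2)" using elim by (smt (verit) zero_le_power2)
    then have "1 / 2 * (t n)\<^sup>2 * (norm (W n))\<^sup>2 < I (m (t n *\<^sub>R W n))"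
      using t(2)[of n] by (simp add: tU field_simps)
    then show ?case by (simp add: Jtilde_def J_eq ppm power_mult_distrib)
  qed
qed

text \<open>The bound \<open>R\<close> is uniform for rays near \<open>w\<close>; this confines the
  maximizers on nearby rays to a compact interval.\<close>

lemma Phi_neg_far:
  assumes w: "w \<in> P" "w \<noteq> 0"
  shows "\<exists>R d. d > 0 \<and> R > 0 \<and> (\<forall>w'\<in>P. \<forall>t. dist w' w < d \<longrightarrow> t \<ge> R \<longrightarrow> \<Phi> (t *\<^sub>R w') < 0)"
proof -
  have "\<exists>n. \<forall>w'\<in>P. \<forall>t. dist w' w < 1 / real (Suc n) \<longrightarrow> t \<ge> real (Suc n) \<longrightarrow> \<Phi> (t *\<^sub>R w') < 0"
  proof (rule ccontr)
    assume "\<not> ?thesis"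
    then have "\<forall>n. \<exists>w' t. w' \<in> P \<and> dist w' w < 1 / real (Suc n) \<and> t \<ge> real (Suc n) \<and> \<not> \<Phi> (t *\<^sub>R w') < 0"
      by blast
    then obtain W t where W: "\<And>n. W n \<in> P" "\<And>n. dist (W n) w < 1 / real (Suc n)"
      "\<And>n. t n \<ge> real (Suc n)" "\<And>n. \<not> \<Phi> (t n *\<^sub>R W n) < 0"
      by metis
    have "dist (W n) w \<le> inverse (real (Suc n))" for n
      using W(2)[of n] by (simp add: inverse_eq_divide)
    then have "(\<lambda>n. dist (W n) w) \<longlonglongrightarrow> 0"
      by (intro tendsto_sandwich[OF _ _ tendsto_const LIMSEQ_inverse_real_of_nat] always_eventually) auto
    then have "W \<longlonglongrightarrow> w" by (rule tendsto_dist_iff[THEN iffD2])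
    moreover have "real n \<le> t n" for n using W(3)[of n] by simp
    then have "filterlim t at_top sequentially"
      by (intro filterlim_at_top_mono[OF filterlim_real_sequentially] always_eventually) auto
    moreover have "t n > 0" for n using W(3)[of n] by simp
    ultimately have "\<forall>\<^sub>F n in sequentially. \<Phi> (t n *\<^sub>R W n) < 0"
      using W(1) w by (intro Phi_eventually_neg) auto
    then show False using W(4) by simp
  qed
  then obtain n where "\<forall>w'\<in>P. \<forall>t. dist w' w < 1 / real (Suc n) \<longrightarrow> t \<ge> real (Suc n) \<longrightarrow>
    \<Phi> (t *\<^sub>R w') < 0" ..
  then show ?thesis by (intro exI[of _ "real (Suc n)"] exI[of _ "1 / real (Suc n)"]) simp
qed

lemma ray_maximum:
  assumes w: "w \<in> P" "w \<noteq> 0"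
  obtains t where "t > 0" "\<And>s. s \<ge> 0 \<Longrightarrow> \<Phi> (s *\<^sub>R w) \<le> \<Phi> (t *\<^sub>R w)" "a \<le> \<Phi> (t *\<^sub>R w)"
proof -
  obtain R d where R: "d > 0" "R > 0" "\<forall>w'\<in>P. \<forall>t. dist w' w < d \<longrightarrow> t \<ge> R \<longrightarrow> \<Phi> (t *\<^sub>R w') < 0"
    using Phi_neg_far[OF w] by (elim exE conjE)
  have far: "\<Phi> (t *\<^sub>R w) < 0" if "t \<ge> R" for t using R(1,3) w(1) that by simp
  obtain t where t: "t \<in> {0..R}" "\<And>s. s \<in> {0..R} \<Longrightarrow> \<Phi> (s *\<^sub>R w) \<le> \<Phi> (t *\<^sub>R w)"
    using continuous_attains_sup[OF compact_Icc _ Phi_ray_cont[OF w(1)], of 0 R] R(2) by force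
  have all: "\<Phi> (s *\<^sub>R w) \<le> \<Phi> (t *\<^sub>R w)" if "s \<ge> 0" for s
  proof (cases "s \<le> R")
    case False
    then show ?thesis using far[of s] t(2)[of 0] R(2) Phi_0 by simp
  qed (use t(2)[of s] that in simp)
  have "a \<le> \<Phi> (t *\<^sub>R w)"
    using ray_sphere_bound[OF w] all[of "r / norm w"] r_pos by simp
  moreover from this have "t \<noteq> 0" using Phi_0 a_pos by auto
  then have "t > 0" using t(1) by simp
  ultimately show thesis using that all by blast
qed

lemma ray_maximum_N:
  assumes w: "w \<in> P" "w \<noteq> 0" and t: "t > 0" "\<And>s. s \<ge> 0 \<Longrightarrow> \<Phi> (s *\<^sub>R w) \<le> \<Phi> (t *\<^sub>R w)"
  shows "m (t *\<^sub>R w) \<in> N_set P T I"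
proof (rule critical_N)
  have "DJ (m (t *\<^sub>R w)) w = 0"
    by (rule DERIV_local_max[OF Phi_ray_line[OF w(1)], where d = t]) (use t in auto)
  then show "DJ (m (t *\<^sub>R w)) (t *\<^sub>R w) = 0" by (simp add: blinfun.scaleR_right)
qed (use w t(1) in \<open>auto intro: P_scale\<close>)

lemma N_lower_bound:
  assumes "u \<in> N_set P T I"
  shows "a \<le> J u"
proof -
  have "a \<le> \<Phi> ((r / norm (pp u)) *\<^sub>R pp u)" by (rule ray_sphere_bound) (use N_E[OF assms] in simp_all)
  also have "\<dots> = J (m ((r / norm (pp u)) *\<^sub>R pp u))" by (simp add: Jtilde_def)
  also have "\<dots> \<le> J u"
    by (rule N_maximal[OF assms, of "r / norm (pp u)"]) (use r_pos in \<open>auto simp: pp_m P_scale\<close>)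
  finally show ?thesis .
qed

section \<open>Comparison of the two minimax levels\<close>

lemma c_N_real:
  obtains c where "c_N P T I = ereal c" "a \<le> c"
proof -
  obtain v where v: "v \<in> P" "norm v = r" using sphere_nonempty .
  then have "v \<noteq> 0" using r_pos by auto
  then obtain t where "t > 0" "\<And>s. s \<ge> 0 \<Longrightarrow> \<Phi> (s *\<^sub>R v) \<le> \<Phi> (t *\<^sub>R v)" using ray_maximum[OF v(1)] by metis
  then have "m (t *\<^sub>R v) \<in> N_set P T I" using v \<open>v \<noteq> 0\<close> by (intro ray_maximum_N) auto
  then have upper: "c_N P T I \<le> ereal (J (m (t *\<^sub>R v)))" unfolding c_N_def by (rule INF_lower)
  have lower: "ereal a \<le> c_N P T I" unfolding c_N_def by (rule INF_greatest) (simp add: N_lower_bound)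
  from upper lower obtain c where "c_N P T I = ereal c" by (cases "c_N P T I") auto
  with lower show thesis by (intro that[of c]) auto
qed

lemma c_M_le_c_N: "c_M P T I r \<le> c_N P T I"
  unfolding c_N_def
proof (rule INF_greatest)
  fix u assume u: "u \<in> N_set P T I"
  define w where "w = pp u"
  have w: "w \<in> P" "w \<noteq> 0" using N_E[OF u] by (auto simp: w_def)
  have max: "\<Phi> (s *\<^sub>R w) \<le> J u" if "s \<ge> 0" for s
    using N_maximal[OF u that, of "m (s *\<^sub>R w)"] w(1) by (simp add: Jtilde_def pp_m P_scale w_def)
  obtain R d where R: "d > 0" "R > 0" "\<forall>w'\<in>P. \<forall>t. dist w' w < d \<longrightarrow> t \<ge> R \<longrightarrow> \<Phi> (t *\<^sub>R w') < 0"
    using Phi_neg_far[OF w] by (elim exE conjE)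
  \<comment> \<open>Beyond \<open>R\<close> the functional is negative; the second entry makes the
    end point of the path longer than \<open>r\<close>.\<close>
  define S where "S = max R ((r + 1) / norm w)"
  have S: "S > 0" "\<Phi> (S *\<^sub>R w) < 0" using R w by (auto simp: S_def)
  have "(r + 1) / norm w * norm w \<le> S * norm w" by (intro mult_right_mono) (auto simp: S_def)
  then have Sr: "r < norm (S *\<^sub>R w)" using w S(1) by simp
  define \<gamma> where "\<gamma> t = m ((t * S) *\<^sub>R w)" for t
  have "continuous_on {0..1} \<gamma>" unfolding \<gamma>_def
    by (rule continuous_on_compose2[OF m_cont]) (auto intro!: continuous_intros P_scale w)
  then have "\<gamma> \<in> Gamma_paths P T I r"
    using w S Sr unfolding Gamma_paths_def \<gamma>_def
    by (auto simp: m_0 m_M P_scale pp_m Jtilde_def)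
  then have "c_M P T I r \<le> (SUP t\<in>{0..1}. ereal (J (\<gamma> t)))" unfolding c_M_def by (rule INF_lower)
  also have "\<dots> \<le> ereal (J u)"
  proof (rule SUP_least)
    fix t :: real assume "t \<in> {0..1}"
    then show "ereal (J (\<gamma> t)) \<le> ereal (J u)"
      using max[of "t * S"] S(1) by (simp add: \<gamma>_def Jtilde_def)
  qed
  finally show "c_M P T I r \<le> ereal (J u)" .
qed

text \<open>Needed twice: for the sign of the radial derivative near \<open>0\<close>, and to keep
  almost critical points away from \<open>0\<close>.\<close>

lemma small_ball:
  shows "\<exists>\<rho>>0. \<rho> \<le> r \<and> (\<forall>u\<in>P. norm u < \<rho> \<longrightarrow> \<Phi> u < a)"
proof -
  obtain d where d: "d > 0" "\<forall>u\<in>P. dist u 0 < d \<longrightarrow> dist (\<Phi> u) (\<Phi> 0) < a"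
    using Phi_cont zero_P a_pos unfolding continuous_on_iff by blast
  then have "\<forall>u\<in>P. norm u < min d r \<longrightarrow> \<Phi> u < a" by (auto simp: Phi_0 dist_real_def)
  then show ?thesis using d(1) r_pos by (intro exI[of _ "min d r"]) auto
qed

text \<open>With a negative derivative \<open>\<Phi>\<close> would first drop along the ray and then
  rise to at least \<open>a > \<Phi> u\<close> at radius \<open>r\<close>, against
  quasi-concavity.\<close>

lemma radial_derivative_nonneg_near_0:
  assumes \<rho>: "\<rho> \<le> r" "\<forall>u\<in>P. norm u < \<rho> \<longrightarrow> \<Phi> u < a" and u: "u \<in> P" "norm u < \<rho>"
  shows "0 \<le> DJ (m u) u"
proof (rule ccontr)
  assume neg: "\<not> ?thesis"
  then have "u \<noteq> 0" by auto
  define R where "R = r / norm u"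
  have R: "R > 1" using u \<rho>(1) \<open>u \<noteq> 0\<close> by (simp add: R_def)
  have "((\<lambda>s. \<Phi> (s *\<^sub>R u)) has_real_derivative DJ (m u) u) (at 1)"
    using Phi_ray_line[OF u(1), of 1] by simp
  then obtain d where d: "d > 0" "\<And>h. 0 < h \<Longrightarrow> h < d \<Longrightarrow> \<Phi> ((1 + h) *\<^sub>R u) < \<Phi> (1 *\<^sub>R u)"
    using DERIV_neg_dec_right neg by (metis not_le)
  define h where "h = min (d / 2) (R - 1)"
  have h: "0 < h" "h < d" "1 + h \<le> R" using d(1) R by (auto simp: h_def)
  have "a \<le> \<Phi> (R *\<^sub>R u)" unfolding R_def by (rule ray_sphere_bound) (use u \<open>u \<noteq> 0\<close> in auto)
  moreover have "\<Phi> u < a" using \<rho>(2) u by blast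
  ultimately show False
    using ray_quasiconcave[OF u(1), of 1 "1 + h" R] h d(2)[OF h(1,2)] by simp
qed

text \<open>A zero derivative would make \<open>\<Phi> u\<close> a ray maximum, hence at least
  \<open>\<Phi> 0 = 0\<close>; a positive one would create a dip between \<open>0\<close> and
  \<open>u\<close>.\<close>

lemma radial_derivative_neg:
  assumes u: "u \<in> P" "\<Phi> u < 0"
  shows "DJ (m u) u < 0"
proof (rule ccontr)
  assume nonneg: "\<not> ?thesis"
  have "u \<noteq> 0" using u Phi_0 by auto
  have "DJ (m u) u \<noteq> 0" using critical_ray_maximal[OF u(1) \<open>u \<noteq> 0\<close>, of 0] Phi_0 u(2) by auto
  then have "DJ (m u) u > 0" using nonneg by simp
  moreover have "((\<lambda>s. \<Phi> (s *\<^sub>R u)) has_real_derivative DJ (m u) u) (at 1)"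
    using Phi_ray_line[OF u(1), of 1] by simp
  ultimately obtain d where d: "d > 0" "\<And>h. 0 < h \<Longrightarrow> h < d \<Longrightarrow> \<Phi> ((1 - h) *\<^sub>R u) < \<Phi> (1 *\<^sub>R u)"
    using DERIV_pos_inc_left by metis
  define h where "h = min (d / 2) 1"
  have h: "0 < h" "h < d" "h \<le> 1" using d(1) by (auto simp: h_def)
  show False
    using ray_quasiconcave[OF u(1), of 0 "1 - h" 1] h d(2)[OF h(1,2)] u(2) Phi_0 by simp
qed

text \<open>The radial derivative \<open>\<Phi>' u [u]\<close> is nonnegative near \<open>0\<close> and negative at the end of the
  path; at its last zero the path meets the Nehari set.\<close>

lemma path_meets_N:
  assumes \<delta>: "continuous_on {0..1} \<delta>" "\<And>t :: real. t \<in> {0..1} \<Longrightarrow> \<delta> t \<in> P" "\<delta> 0 = 0" "\<Phi> (\<delta> 1) < 0"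
  obtains t where "t \<in> {0..1}" "m (\<delta> t) \<in> N_set P T I"
proof -
  obtain \<rho> where \<rho>: "\<rho> > 0" "\<rho> \<le> r" "\<forall>u\<in>P. norm u < \<rho> \<longrightarrow> \<Phi> u < a"
    using small_ball by blast
  define g where "g t = DJ (m (\<delta> t)) (\<delta> t)" for t
  have g_cont: "continuous_on {0..1} g" unfolding g_def
    by (intro blinfun.continuous_on continuous_on_compose2[OF DPhi_cont] \<delta>) (use \<delta>(2) in auto)
  \<comment> \<open>The last time in \<open>A\<close> is taken because \<open>g\<close> also
    vanishes whenever the path is at \<open>0\<close>, in particular at the start.\<close>
  define A where "A = {0..1} \<inter> g -` {0..}"
  have "compact A" unfolding A_def compact_eq_bounded_closed
    by (intro conjI bounded_Int disjI1 continuous_closed_preimage[OF g_cont]) auto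
  moreover have "0 \<in> A" using \<delta>(3) by (simp add: A_def g_def)
  ultimately obtain t where t: "t \<in> A" "\<And>s. s \<in> A \<Longrightarrow> s \<le> t"
    using compact_attains_sup[of A] by blast
  have t01: "t \<in> {0..1}" "g t \<ge> 0" using t(1) by (auto simp: A_def)
  have "g 1 < 0" unfolding g_def by (rule radial_derivative_neg) (use \<delta> in auto)
  then have "t < 1" using t01 by (cases "t = 1") auto
  have after: "g s < 0" if "t < s" "s \<le> 1" for s
  proof (rule ccontr)
    assume "\<not> g s < 0"
    then have "s \<in> A" using that t01 by (simp add: A_def)
    with t(2)[of s] that show False by simp
  qed
  have "g t \<le> 0"
  proof (rule ccontr)
    assume "\<not> g t \<le> 0"
    then obtain d where d: "d > 0" "\<And>s. s \<in> {0..1} \<Longrightarrow> dist s t < d \<Longrightarrow> dist (g s) (g t) < g t"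
      using g_cont t01 unfolding continuous_on_iff by (metis not_le)
    define s where "s = t + min (d / 2) (1 - t)"
    have "t < s" "s \<le> 1" "dist s t < d" using d(1) \<open>t < 1\<close> by (auto simp: s_def dist_real_def)
    then show False using after[of s] d(2)[of s] t01 by (auto simp: dist_real_def)
  qed
  then have "g t = 0" using t01 by simp
  \<comment> \<open>If the path were at \<open>0\<close> at its last time in \<open>A\<close>, it
    would stay in the small ball for a while afterwards, where \<open>g\<close> is
    nonnegative.\<close>
  moreover have "\<delta> t \<noteq> 0"
  proof
    assume "\<delta> t = 0"
    then obtain d where d: "d > 0" "\<And>s. s \<in> {0..1} \<Longrightarrow> dist s t < d \<Longrightarrow> norm (\<delta> s) < \<rho>"
      using \<delta>(1) t01 \<rho>(1) unfolding continuous_on_iff by (metis dist_0_norm dist_commute)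
    define s where "s = t + min (d / 2) (1 - t)"
    have s: "t < s" "s \<le> 1" "dist s t < d" "s \<in> {0..1}"
      using d(1) \<open>t < 1\<close> t01 by (auto simp: s_def dist_real_def)
    then have "0 \<le> g s" unfolding g_def
      using d(2) by (intro radial_derivative_nonneg_near_0[OF \<rho>(2,3)] \<delta>(2)) auto
    with after[OF s(1,2)] show False by simp
  qed
  ultimately have "m (\<delta> t) \<in> N_set P T I"
    by (intro critical_N \<delta>(2) t01) (auto simp: g_def)
  then show thesis by (rule that[OF t01(1)])
qed

lemma c_N_le_c_M: "c_N P T I \<le> c_M P T I r"
  unfolding c_M_def
proof (rule INF_greatest)
  fix \<gamma> assume "\<gamma> \<in> Gamma_paths P T I r"
  then have \<gamma>: "continuous_on {0..1} \<gamma>" "\<And>t. t \<in> {0..1} \<Longrightarrow> \<gamma> t \<in> M_set P T I" "\<gamma> 0 = 0"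
    "J (\<gamma> 1) < 0" by (auto simp: Gamma_paths_def)
  have m\<gamma>: "m (pp (\<gamma> t)) = \<gamma> t" if "t \<in> {0..1}" for t by (rule m_unique[OF \<gamma>(2)[OF that]])
  have "continuous_on {0..1} (\<lambda>t. pp (\<gamma> t))"
    by (rule bounded_linear.continuous_on[OF bounded_linear_pp \<gamma>(1)])
  then obtain t where t: "t \<in> {0..1}" "m (pp (\<gamma> t)) \<in> N_set P T I"
    by (rule path_meets_N) (use \<gamma> m\<gamma>[of 1] zero_P in \<open>auto simp: Jtilde_def\<close>)
  then have "c_N P T I \<le> ereal (J (\<gamma> t))" unfolding c_N_def by (intro INF_lower) (simp add: m\<gamma>)
  also have "\<dots> \<le> (SUP t\<in>{0..1}. ereal (J (\<gamma> t)))" by (rule SUP_upper[OF t(1)])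
  finally show "c_N P T I \<le> (SUP t\<in>{0..1}. ereal (J (\<gamma> t)))" .
qed

lemma c_M_eq_c_N: "c_M P T I r = c_N P T I"
  by (rule antisym[OF c_M_le_c_N c_N_le_c_M])

end

section \<open>The Cerami sequence\<close>

context mountain_pass_functional
begin

section \<open>Ray maxima and their minimization on the unit sphere\<close>

text \<open>The real supremum is not a default value for \<open>w\<close> in \<open>P - {0}\<close>:
  there it is attained, at a positive \<open>t\<close>.\<close>

definition \<Psi> :: "'a \<Rightarrow> real" where
  "\<Psi> w = (SUP t\<in>{0..}. \<Phi> (t *\<^sub>R w))"

lemma Psi_upper:
  assumes w: "w \<in> P" "w \<noteq> 0" and s: "s \<ge> 0"
  shows "\<Phi> (s *\<^sub>R w) \<le> \<Psi> w"
proof -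
  obtain t where "\<And>s. s \<ge> 0 \<Longrightarrow> \<Phi> (s *\<^sub>R w) \<le> \<Phi> (t *\<^sub>R w)" using ray_maximum[OF w] by metis
  then show ?thesis unfolding \<Psi>_def
    by (intro cSUP_upper bdd_aboveI2[where M = "\<Phi> (t *\<^sub>R w)"]) (use s in auto)
qed

lemma Psi_attained:
  assumes w: "w \<in> P" "w \<noteq> 0"
  shows "\<exists>t>0. \<Phi> (t *\<^sub>R w) = \<Psi> w"
proof -
  obtain t where t: "t > 0" "\<And>s. s \<ge> 0 \<Longrightarrow> \<Phi> (s *\<^sub>R w) \<le> \<Phi> (t *\<^sub>R w)" using ray_maximum[OF w] by metis
  have "\<Psi> w \<le> \<Phi> (t *\<^sub>R w)" unfolding \<Psi>_def by (rule cSUP_least) (use t in auto)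
  with Psi_upper[OF w, of t] t(1) show ?thesis by (intro exI[of _ t]) simp
qed

lemma Psi_ge_a:
  assumes w: "w \<in> P" "w \<noteq> 0"
  shows "a \<le> \<Psi> w"
  using ray_maximum[OF w] Psi_upper[OF w] by (metis less_imp_le order_trans)

lemma Psi_scale_le:
  assumes w: "w \<in> P" "w \<noteq> 0" and k: "k > 0"
  shows "\<Psi> (k *\<^sub>R w) \<le> \<Psi> w"
proof -
  obtain t where t: "t > 0" "\<Phi> (t *\<^sub>R k *\<^sub>R w) = \<Psi> (k *\<^sub>R w)"
    using Psi_attained[of "k *\<^sub>R w"] w k by (auto intro: P_scale)
  then show ?thesis using Psi_upper[OF w, of "t * k"] k by simp
qed

lemma Psi_ge_c_N:
  assumes w: "w \<in> P" "w \<noteq> 0"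
  shows "c_N P T I \<le> ereal (\<Psi> w)"
proof -
  obtain t where t: "t > 0" "\<Phi> (t *\<^sub>R w) = \<Psi> w" using Psi_attained[OF w] by blast
  have "m (t *\<^sub>R w) \<in> N_set P T I"
    by (rule ray_maximum_N[OF w t(1)]) (simp add: t(2) Psi_upper[OF w])
  then have "c_N P T I \<le> ereal (J (m (t *\<^sub>R w)))" unfolding c_N_def by (rule INF_lower)
  then show ?thesis using t(2) by (simp add: Jtilde_def)
qed

lemma Psi_near_c_N:
  assumes c: "c_N P T I = ereal c" and e: "e > 0"
  shows "\<exists>w\<in>P. norm w = 1 \<and> \<Psi> w \<le> c + e"
proof -
  have "c_N P T I < ereal (c + e)" using c e by simp
  then obtain u where u: "u \<in> N_set P T I" "J u < c + e" unfolding c_N_def INF_less_iff by auto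
  define w where "w = (1 / norm (pp u)) *\<^sub>R pp u"
  have w: "w \<in> P" "norm w = 1" using N_E[OF u(1)] by (auto simp: w_def intro: P_scale)
  then have "w \<noteq> 0" by auto
  then obtain t where t: "t > 0" "\<Phi> (t *\<^sub>R w) = \<Psi> w" using Psi_attained[OF w(1)] by blast
  have "J (m (t *\<^sub>R w)) \<le> J u"
    by (rule N_maximal[OF u(1), of "t / norm (pp u)"]) (use t w in \<open>simp_all add: pp_m P_scale w_def\<close>)
  then have "\<Psi> w \<le> c + e" using t(2) u(2) by (simp add: Jtilde_def)
  with w show ?thesis by blast
qed

lemma complete_unit_sphere:
  assumes P: "complete P"
  shows "complete {w \<in> P. norm w = 1}"
proof -
  have "closed {w :: 'a. norm w = 1}" by (intro closed_Collect_eq continuous_intros)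
  from complete_Int_closed[OF P this] show ?thesis by (simp add: Int_def)
qed

text \<open>Ekeland's principle on the unit sphere, started at an almost minimizer. Being a supremum
  of continuous functions, \<open>\<Psi>\<close> is lower semicontinuous: the maximizer for
  \<open>w\<close> still tests nearby rays.\<close>

lemma Psi_near_minimizer:
  assumes P: "complete P" and c: "c_N P T I = ereal c" and e: "e > 0"
  shows "\<exists>w\<in>P. norm w = 1 \<and> \<Psi> w \<le> c + e \<and>
    (\<forall>w'\<in>P. norm w' = 1 \<longrightarrow> \<Psi> w \<le> \<Psi> w' + e * dist w w')"
proof -
  define S where "S = {w \<in> P. norm w = 1}"
  have S: "w \<in> P" "w \<noteq> 0" if "w \<in> S" for w using that by (auto simp: S_def)
  obtain w0 where w0: "w0 \<in> S" "\<Psi> w0 \<le> c + e" using Psi_near_c_N[OF c e] by (auto simp: S_def)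
  have lsc: "\<exists>d>0. \<forall>y\<in>S. dist y w < d \<longrightarrow> k < \<Psi> y" if w: "w \<in> S" and k: "k < \<Psi> w" for w k
  proof -
    obtain t where t: "t > 0" "\<Phi> (t *\<^sub>R w) = \<Psi> w" using Psi_attained[OF S[OF w]] by blast
    have "continuous_on P (\<lambda>w. \<Phi> (t *\<^sub>R w))"
      by (rule continuous_on_compose2[OF Phi_cont]) (auto intro!: continuous_intros P_scale)
    moreover have "\<Psi> w - k > 0" using k by simp
    ultimately obtain d where d: "d > 0" "\<forall>y\<in>P. dist y w < d \<longrightarrow> dist (\<Phi> (t *\<^sub>R y)) (\<Phi> (t *\<^sub>R w)) < \<Psi> w - k"
      using S[OF w] unfolding continuous_on_iff by blast
    have "k < \<Psi> y" if y: "y \<in> S" "dist y w < d" for y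
    proof -
      have "dist (\<Phi> (t *\<^sub>R y)) (\<Phi> (t *\<^sub>R w)) < \<Psi> w - k" using d(2) y S[OF y(1)] by blast
      then have "k < \<Phi> (t *\<^sub>R y)" using t(2) by (simp add: dist_real_def)
      with Psi_upper[OF S[OF y(1)], of t] t(1) show ?thesis by simp
    qed
    with d(1) show ?thesis by blast
  qed
  have "\<exists>w\<in>S. \<Psi> w \<le> \<Psi> w0 \<and> (\<forall>y\<in>S. \<Psi> w \<le> \<Psi> y + e * dist w y)"
    by (rule ekeland[where b = a])
      (use w0 e lsc Psi_ge_a S complete_unit_sphere[OF P, folded S_def] in auto)
  then obtain w where "w \<in> S" "\<Psi> w \<le> \<Psi> w0" "\<forall>y\<in>S. \<Psi> w \<le> \<Psi> y + e * dist w y" by blast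
  with w0(2) show ?thesis by (intro bexI[of _ w]) (auto simp: S_def)
qed

section \<open>First variation and a maximizer common to all directions\<close>

lemma Phi_scaled_line:
  assumes "w \<in> P" "h \<in> P"
  shows "((\<lambda>s. \<Phi> (t *\<^sub>R (w + s *\<^sub>R h))) has_real_derivative DJ (m (t *\<^sub>R (w + s *\<^sub>R h))) (t *\<^sub>R h)) (at s)"
  using Phi_line[of "t *\<^sub>R w" "t *\<^sub>R h" s] assms
  by (simp add: P_scale scaleR_add_right mult.commute)

text \<open>First variation of the quasi-concavity of the rays through \<open>w + s h\<close> as \<open>s\<close> tends to \<open>0\<close>.\<close>

lemma variation_quasiconcave:
  assumes w: "w \<in> P" and h: "h \<in> P" and t: "0 \<le> t1" "t1 \<le> t" "t \<le> t2"
    and eq: "\<Phi> (t1 *\<^sub>R w) = \<Phi> (t *\<^sub>R w)" "\<Phi> (t2 *\<^sub>R w) = \<Phi> (t *\<^sub>R w)"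
  shows "min (DJ (m (t1 *\<^sub>R w)) (t1 *\<^sub>R h)) (DJ (m (t2 *\<^sub>R w)) (t2 *\<^sub>R h)) \<le> DJ (m (t *\<^sub>R w)) (t *\<^sub>R h)"
proof (rule ccontr)
  assume neg: "\<not> ?thesis"
  \<comment> \<open>The values agree at \<open>s = 0\<close> and the one at \<open>t\<close> grows
    more slowly, so for small \<open>s\<close> it lies below both outer values on the ray through
    \<open>w + s h\<close>.\<close>
  have drop: "\<exists>d>0. \<forall>s>0. s < d \<longrightarrow> \<Phi> (t *\<^sub>R (w + s *\<^sub>R h)) < \<Phi> (t' *\<^sub>R (w + s *\<^sub>R h))"
    if eq: "\<Phi> (t' *\<^sub>R w) = \<Phi> (t *\<^sub>R w)"
      and less: "DJ (m (t *\<^sub>R w)) (t *\<^sub>R h) < DJ (m (t' *\<^sub>R w)) (t' *\<^sub>R h)" for t'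
  proof -
    define f where "f s = \<Phi> (t *\<^sub>R (w + s *\<^sub>R h)) - \<Phi> (t' *\<^sub>R (w + s *\<^sub>R h))" for s
    have "(f has_real_derivative DJ (m (t *\<^sub>R w)) (t *\<^sub>R h) - DJ (m (t' *\<^sub>R w)) (t' *\<^sub>R h)) (at 0)"
      unfolding f_def using DERIV_diff[OF Phi_scaled_line[OF w h, of t 0] Phi_scaled_line[OF w h, of t' 0]]
      by simp
    then have "\<exists>d>0. \<forall>s>0. s < d \<longrightarrow> f (0 + s) < f 0"
      by (rule DERIV_neg_dec_right) (use less in simp)
    moreover have "f 0 = 0" using eq by (simp add: f_def)
    ultimately show ?thesis by (simp add: f_def)
  qed
  obtain d1 where d1: "d1 > 0" "\<forall>s>0. s < d1 \<longrightarrow> \<Phi> (t *\<^sub>R (w + s *\<^sub>R h)) < \<Phi> (t1 *\<^sub>R (w + s *\<^sub>R h))"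
    using drop[OF eq(1)] neg by (auto simp: not_le)
  obtain d2 where d2: "d2 > 0" "\<forall>s>0. s < d2 \<longrightarrow> \<Phi> (t *\<^sub>R (w + s *\<^sub>R h)) < \<Phi> (t2 *\<^sub>R (w + s *\<^sub>R h))"
    using drop[OF eq(2)] neg by (auto simp: not_le)
  define s where "s = min d1 d2 / 2"
  have s: "s > 0" "s < d1" "s < d2" using d1(1) d2(1) by (auto simp: s_def min_def)
  have "w + s *\<^sub>R h \<in> P" using w h by (intro P_add P_scale)
  from ray_quasiconcave[OF this t] d1(2) d2(2) s show False by (auto simp: min_le_iff_disj not_le)
qed

text \<open>Normalising moves \<open>v\<close> by the gap between \<open>norm v\<close> and
  \<open>norm w = 1\<close>, at most \<open>dist w v\<close>. This is the origin of the bounds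
  \<open>2 * e\<close>.\<close>

lemma dist_normalize:
  fixes w v :: "'b::real_normed_vector"
  assumes "norm w = 1" "v \<noteq> 0"
  shows "dist w ((1 / norm v) *\<^sub>R v) \<le> 2 * dist w v"
proof -
  have "v - (1 / norm v) *\<^sub>R v = (1 - 1 / norm v) *\<^sub>R v" by (simp add: algebra_simps)
  then have "dist v ((1 / norm v) *\<^sub>R v) = \<bar>1 - 1 / norm v\<bar> * norm v" by (simp add: dist_norm)
  also have "\<dots> = \<bar>norm v - norm w\<bar>" using assms by (simp add: abs_mult_pos' algebra_simps flip: abs_mult_pos)
  also have "\<dots> \<le> dist w v" using norm_triangle_ineq3[of v w] by (simp add: dist_norm norm_minus_commute)
  finally show ?thesis using dist_triangle[of w "(1 / norm v) *\<^sub>R v" v] by simp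
qed

text \<open>Danskin's argument: maximizers on the rays through \<open>w + s h\<close> accumulate, as \<open>s\<close> tends
  to \<open>0\<close>, at a maximizer on the ray through \<open>w\<close>.\<close>

lemma danskin:
  assumes w: "w \<in> P" "norm w = 1" and h: "h \<in> P" "norm h \<le> 1" and e: "e > 0"
    and min: "\<forall>w'\<in>P. norm w' = 1 \<longrightarrow> \<Psi> w \<le> \<Psi> w' + e * dist w w'"
  shows "\<exists>t\<ge>0. \<Phi> (t *\<^sub>R w) = \<Psi> w \<and> - (2 * e) \<le> DJ (m (t *\<^sub>R w)) (t *\<^sub>R h)"
proof -
  have w0: "w \<noteq> 0" using w(2) by auto
  obtain R d where R: "d > 0" "R > 0" "\<forall>w'\<in>P. \<forall>t. dist w' w < d \<longrightarrow> t \<ge> R \<longrightarrow> \<Phi> (t *\<^sub>R w') < 0"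
    using Phi_neg_far[OF w(1) w0] by (elim exE conjE)
  \<comment> \<open>The bound \<open>1 / 2\<close> keeps \<open>v n\<close> away from
    \<open>0\<close>, the bound \<open>d / 2\<close> keeps it where \<open>Phi_neg_far\<close> holds
    with the same \<open>R\<close>.\<close>
  define s where "s n = min (1 / 2) (d / 2) * inverse (real (Suc n))" for n
  define v where "v n = w + s n *\<^sub>R h" for n
  have s_pos: "s n > 0" for n using R(1) by (simp add: s_def)
  have s_le: "s n \<le> min (1 / 2) (d / 2)" for n
  proof -
    have "inverse (real (Suc n)) \<le> 1" by (simp add: inverse_eq_divide)
    then show ?thesis unfolding s_def using R(1) by (intro mult_left_le) auto
  qed
  have s_lim: "s \<longlonglongrightarrow> 0"
    unfolding s_def using tendsto_mult_left[OF LIMSEQ_inverse_real_of_nat] by fastforce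
  have sh: "norm (s n *\<^sub>R h) \<le> s n" for n using s_pos[of n] h(2) by (simp add: mult_left_le)
  have dist_v: "dist w (v n) \<le> s n" for n using sh[of n] by (simp add: v_def dist_norm)
  have vP: "v n \<in> P" for n using w h by (simp add: v_def P_add P_scale)
  have v0: "v n \<noteq> 0" for n
  proof
    assume "v n = 0"
    then have "dist w 0 \<le> s n" using dist_v[of n] by simp
    then show False using w(2) s_le[of n] by simp
  qed
  have "\<exists>t>0. \<Phi> (t *\<^sub>R v n) = \<Psi> (v n)" for n by (rule Psi_attained[OF vP v0])
  then obtain \<tau> where \<tau>: "\<And>n. \<tau> n > 0" "\<And>n. \<Phi> (\<tau> n *\<^sub>R v n) = \<Psi> (v n)" by metis
  have Psi_v: "\<Psi> w \<le> \<Psi> (v n) + 2 * e * s n" for n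
  proof -
    define v' where "v' = (1 / norm (v n)) *\<^sub>R v n"
    have v': "v' \<in> P" "norm v' = 1" using vP v0 by (auto simp: v'_def P_scale)
    have "dist w v' \<le> 2 * s n"
      using dist_normalize[OF w(2) v0[of n]] dist_v[of n] by (simp add: v'_def)
    then have "e * dist w v' \<le> 2 * e * s n" using e by simp
    moreover have "\<Psi> w \<le> \<Psi> v' + e * dist w v'" using min v' by blast
    moreover have "\<Psi> v' \<le> \<Psi> (v n)" unfolding v'_def by (rule Psi_scale_le[OF vP v0]) (use v0 in simp)
    ultimately show ?thesis by linarith
  qed
  have \<tau>R: "\<tau> n \<in> {0..R}" for n
  proof (rule ccontr)
    assume "\<tau> n \<notin> {0..R}"
    then have "\<tau> n \<ge> R" using \<tau>(1)[of n] by auto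
    moreover have "dist (v n) w < d" using dist_v[of n] s_le[of n] R(1) by (simp add: dist_commute)
    ultimately have "\<Phi> (\<tau> n *\<^sub>R v n) < 0" using R(3) vP by blast
    then show False using \<tau>(2)[of n] Psi_ge_a[OF vP v0, of n] a_pos by simp
  qed
  \<comment> \<open>From \<open>w\<close> to \<open>v n\<close>, at fixed \<open>\<tau> n\<close>,
    the value rises from at most \<open>\<Psi> w\<close> to \<open>\<Psi> (v n)\<close>, hence drops
    by at most \<open>2 * e * s n\<close>; the mean value theorem gives a point with slope at least
    \<open>- (2 * e)\<close>.\<close>
  have "\<exists>\<sigma>. 0 < \<sigma> \<and> \<sigma> < s n \<and> - (2 * e) \<le> DJ (m (\<tau> n *\<^sub>R (w + \<sigma> *\<^sub>R h))) (\<tau> n *\<^sub>R h)" for n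
  proof -
    obtain \<sigma> where \<sigma>: "0 < \<sigma>" "\<sigma> < s n" "\<Phi> (\<tau> n *\<^sub>R (w + s n *\<^sub>R h)) - \<Phi> (\<tau> n *\<^sub>R (w + 0 *\<^sub>R h)) =
        (s n - 0) * DJ (m (\<tau> n *\<^sub>R (w + \<sigma> *\<^sub>R h))) (\<tau> n *\<^sub>R h)"
      using MVT2[OF s_pos[of n] Phi_scaled_line[OF w(1) h(1)], of "\<tau> n"] by blast
    have "\<Phi> (\<tau> n *\<^sub>R w) \<le> \<Psi> w" using Psi_upper[OF w(1) w0] \<tau>(1)[of n] by simp
    then have "- (2 * e) * s n \<le> DJ (m (\<tau> n *\<^sub>R (w + \<sigma> *\<^sub>R h))) (\<tau> n *\<^sub>R h) * s n"
      using \<sigma>(3) \<tau>(2)[of n] Psi_v[of n] by (simp add: v_def algebra_simps)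
    then show ?thesis using \<sigma>(1,2) s_pos[of n] by (auto simp only: mult_le_cancel_right_pos)
  qed
  then obtain \<sigma> where \<sigma>: "\<And>n. 0 < \<sigma> n" "\<And>n. \<sigma> n < s n"
    "\<And>n. - (2 * e) \<le> DJ (m (\<tau> n *\<^sub>R (w + \<sigma> n *\<^sub>R h))) (\<tau> n *\<^sub>R h)" by metis
  obtain t and q :: "nat \<Rightarrow> nat" where q: "t \<in> {0..R}" "strict_mono q" "(\<lambda>n. \<tau> (q n)) \<longlonglongrightarrow> t"
    using compact_Icc[of 0 R] \<tau>R unfolding compact_def o_def by meson
  have \<sigma>_lim: "\<sigma> \<longlonglongrightarrow> 0"
    by (intro tendsto_sandwich[OF _ _ tendsto_const s_lim] always_eventually allI) (use \<sigma> in \<open>auto intro: less_imp_le\<close>)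
  have \<sigma>q: "(\<lambda>n. \<sigma> (q n)) \<longlonglongrightarrow> 0" and sq: "(\<lambda>n. s (q n)) \<longlonglongrightarrow> 0"
    using LIMSEQ_subseq_LIMSEQ[OF \<sigma>_lim q(2)] LIMSEQ_subseq_LIMSEQ[OF s_lim q(2)] by (simp_all add: o_def)
  have base: "(\<lambda>n. \<tau> (q n) *\<^sub>R (w + x n *\<^sub>R h)) \<longlonglongrightarrow> t *\<^sub>R w" if "x \<longlonglongrightarrow> 0" for x
  proof -
    have "(\<lambda>n. \<tau> (q n) *\<^sub>R (w + x n *\<^sub>R h)) \<longlonglongrightarrow> t *\<^sub>R (w + 0 *\<^sub>R h)" by (intro tendsto_intros q(3) that)
    then show ?thesis by simp
  qed
  have inP: "\<tau> (q n) *\<^sub>R (w + x *\<^sub>R h) \<in> P" and twP: "t *\<^sub>R w \<in> P" for n x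
    using w h by (auto intro: P_add P_scale)
  have "(\<lambda>n. DJ (m (\<tau> (q n) *\<^sub>R (w + \<sigma> (q n) *\<^sub>R h)))) \<longlonglongrightarrow> DJ (m (t *\<^sub>R w))"
    by (rule continuous_on_tendsto_compose[OF DPhi_cont base[OF \<sigma>q] twP]) (simp add: inP)
  then have "(\<lambda>n. DJ (m (\<tau> (q n) *\<^sub>R (w + \<sigma> (q n) *\<^sub>R h))) (\<tau> (q n) *\<^sub>R h)) \<longlonglongrightarrow> DJ (m (t *\<^sub>R w)) (t *\<^sub>R h)"
    by (intro blinfun.tendsto tendsto_scaleR tendsto_const q(3))
  then have "- (2 * e) \<le> DJ (m (t *\<^sub>R w)) (t *\<^sub>R h)"
    by (rule LIMSEQ_le_const) (use \<sigma>(3) in auto)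
  moreover have "\<Psi> w \<le> \<Phi> (t *\<^sub>R w)"
  proof (rule LIMSEQ_le_const)
    have "(\<lambda>n. \<Phi> (\<tau> (q n) *\<^sub>R (w + s (q n) *\<^sub>R h)) + 2 * e * s (q n)) \<longlonglongrightarrow> \<Phi> (t *\<^sub>R w) + 2 * e * 0"
      by (intro tendsto_add tendsto_mult tendsto_const sq continuous_on_tendsto_compose[OF Phi_cont base[OF sq] twP])
        (simp add: inP)
    then show "(\<lambda>n. \<Phi> (\<tau> (q n) *\<^sub>R (w + s (q n) *\<^sub>R h)) + 2 * e * s (q n)) \<longlonglongrightarrow> \<Phi> (t *\<^sub>R w)" by simp
    show "\<exists>N. \<forall>n\<ge>N. \<Psi> w \<le> \<Phi> (\<tau> (q n) *\<^sub>R (w + s (q n) *\<^sub>R h)) + 2 * e * s (q n)"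
      using Psi_v \<tau>(2) by (auto simp: v_def)
  qed
  ultimately show ?thesis using Psi_upper[OF w(1) w0, of t] q(1) by (intro exI[of _ t]) auto
qed

text \<open>Quasi-concavity makes the set of maximizers an interval, negativity far out makes it
  compact, and \<open>\<Phi> 0 = 0 < a\<close> excludes \<open>0\<close>.\<close>

lemma maximizer_interval:
  assumes w: "w \<in> P" "w \<noteq> 0"
  shows "\<exists>t1 t2. 0 < t1 \<and> t1 \<le> t2 \<and> {t. 0 \<le> t \<and> \<Phi> (t *\<^sub>R w) = \<Psi> w} = {t1..t2}"
proof -
  obtain R d where R: "d > 0" "R > 0" "\<forall>w'\<in>P. \<forall>t. dist w' w < d \<longrightarrow> t \<ge> R \<longrightarrow> \<Phi> (t *\<^sub>R w') < 0"
    using Phi_neg_far[OF w] by (elim exE conjE)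
  define A where "A = {t. 0 \<le> t \<and> \<Phi> (t *\<^sub>R w) = \<Psi> w}"
  have pos: "0 < \<Psi> w" using Psi_ge_a[OF w] a_pos by simp
  have "A = {0..R} \<inter> (\<lambda>t. \<Phi> (t *\<^sub>R w)) -` {\<Psi> w}"
  proof -
    have "t \<le> R" if "t \<in> A" for t
    proof (rule ccontr)
      assume "\<not> t \<le> R"
      then have "\<Phi> (t *\<^sub>R w) < 0" using R(1,3) w(1) by simp
      then show False using that pos by (simp add: A_def)
    qed
    then show ?thesis by (auto simp: A_def)
  qed
  moreover have "closed ({0..R} \<inter> (\<lambda>t. \<Phi> (t *\<^sub>R w)) -` {\<Psi> w})"
    by (intro continuous_closed_preimage Phi_ray_cont w(1)) auto
  ultimately have "compact A" by (simp add: compact_eq_bounded_closed bounded_Int)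
  moreover obtain t where "t > 0" "\<Phi> (t *\<^sub>R w) = \<Psi> w" using Psi_attained[OF w] by blast
  then have "t \<in> A" by (simp add: A_def)
  then have "A \<noteq> {}" by blast
  ultimately obtain t1 t2 where t: "t1 \<in> A" "\<forall>t\<in>A. t1 \<le> t" "t2 \<in> A" "\<forall>t\<in>A. t \<le> t2"
    using compact_attains_inf[of A] compact_attains_sup[of A] by metis
  have "t \<in> A" if "t1 \<le> t" "t \<le> t2" for t
  proof -
    have "0 \<le> t1" "\<Phi> (t1 *\<^sub>R w) = \<Psi> w" "\<Phi> (t2 *\<^sub>R w) = \<Psi> w" using t by (auto simp: A_def)
    then show ?thesis using ray_quasiconcave[OF w(1), of t1 t t2] Psi_upper[OF w, of t] that by (simp add: A_def)
  qed
  then have "{t1..t2} \<subseteq> A" by auto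
  moreover have "A \<subseteq> {t1..t2}" using t(2,4) by auto
  ultimately have "A = {t1..t2}" by blast
  moreover have "0 < t1" using t(1) pos Phi_0 by (cases "t1 = 0") (auto simp: A_def)
  moreover have "t1 \<le> t2" using t(2,3) by blast
  ultimately show ?thesis unfolding A_def by (intro exI[of _ t1] exI[of _ t2] conjI)
qed

text \<open>Applied to \<open>h\<close> and \<open>- h\<close>, variation_quasiconcave shows that on the interval of
  maximizers \<open>K t = t \<Phi>' (t w)\<close> lies between \<open>K t1\<close> and \<open>K t2\<close> in every direction, so the curve
  \<open>K\<close> fills the segment from \<open>K t1\<close> to \<open>K t2\<close>. This upgrades one maximizer for each direction
  to a single one.\<close>

lemma single_maximizer:
  assumes w: "w \<in> P" "norm w = 1" and e: "e > 0"
    and min: "\<forall>w'\<in>P. norm w' = 1 \<longrightarrow> \<Psi> w \<le> \<Psi> w' + e * dist w w'"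
  shows "\<exists>t>0. \<Phi> (t *\<^sub>R w) = \<Psi> w \<and> (\<forall>h\<in>P. norm h \<le> 1 \<longrightarrow> \<bar>DJ (m (t *\<^sub>R w)) (t *\<^sub>R h)\<bar> \<le> 2 * e)"
proof -
  have w0: "w \<noteq> 0" using w(2) by auto
  obtain t1 t2 where t12: "0 < t1" "t1 \<le> t2"
    and A: "{t. 0 \<le> t \<and> \<Phi> (t *\<^sub>R w) = \<Psi> w} = {t1..t2}"
    using maximizer_interval[OF w(1) w0] by blast
  have max: "\<Phi> (t *\<^sub>R w) = \<Psi> w" if "t \<in> {t1..t2}" for t using that unfolding A[symmetric] by simp
  define K where "K t h = DJ (m (t *\<^sub>R w)) (t *\<^sub>R h)" for t h
  have K_add: "K t (g + h) = K t g + K t h" and K_scale: "K t (k *\<^sub>R h) = k * K t h" for t g h k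
    by (simp_all add: K_def scaleR_add_right blinfun.add_right blinfun.scaleR_right)
  have K_linear: "linear (K t)" for t by (intro linearI) (simp_all add: K_add K_scale)
  have K_min: "min (K t1 h) (K t2 h) \<le> K t h" if "h \<in> P" "t \<in> {t1..t2}" for h t
    unfolding K_def by (rule variation_quasiconcave) (use w that t12 max in auto)
  have K_max: "K t h \<le> max (K t1 h) (K t2 h)" if "h \<in> P" "t \<in> {t1..t2}" for h t
    using K_min[OF P_scale[OF that(1), of "-1"] that(2)] K_scale[of _ "-1" h] by simp
  define B where "B = {h \<in> P. norm h \<le> 1}"
  have "B = P \<inter> cball 0 1" by (auto simp: B_def)
  then have B: "convex B" using subspace_imp_convex[OF subspaces(1)] by (simp add: convex_Int)
  have "0 \<in> B" using zero_P by (simp add: B_def)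
  \<comment> \<open>The maximizer found for the direction \<open>h\<close> lies in the interval, so
    the larger of the two end values inherits its bound.\<close>
  have "- (2 * e) \<le> max (K t1 h) (K t2 h)" if "h \<in> B" for h
  proof -
    obtain t where t: "t \<ge> 0" "\<Phi> (t *\<^sub>R w) = \<Psi> w" "- (2 * e) \<le> K t h"
      using danskin[OF w _ _ e min, of h] \<open>h \<in> B\<close> by (auto simp: B_def K_def)
    then have "t \<in> {t1..t2}" unfolding A[symmetric] by simp
    with t(3) K_max[of h t] \<open>h \<in> B\<close> show ?thesis by (simp add: B_def)
  qed
  then obtain \<alpha> where \<alpha>: "\<alpha> \<in> {0..1}" "\<forall>h\<in>B. - (2 * e) \<le> (1 - \<alpha>) * K t1 h + \<alpha> * K t2 h"
    using convex_combination_ge[OF K_linear[of t1] K_linear[of t2] B, of "- (2 * e)"] \<open>0 \<in> B\<close> by blast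
  have "\<exists>t\<in>{t1..t2}. \<forall>h\<in>P. K t h = (1 - \<alpha>) * K t1 h + \<alpha> * K t2 h"
  proof (cases "\<forall>h\<in>P. K t1 h = K t2 h")
    case True
    then show ?thesis using t12(2) by (intro bexI[of _ t1]) (auto simp: algebra_simps)
  next
    case False
    then obtain h' where h': "h' \<in> P" "K t1 h' \<noteq> K t2 h'" by blast
    \<comment> \<open>A direction in which the end functionals differ, with its sign fixed; the
      intermediate value theorem along it selects the parameter \<open>t\<close>.\<close>
    define h0 where "h0 = (if K t1 h' < K t2 h' then h' else - 1 *\<^sub>R h')"
    have h0: "h0 \<in> P" "K t1 h0 < K t2 h0"
      using h' P_scale[OF h'(1), of "- 1"] K_scale[of _ "- 1" h'] by (auto simp: h0_def)
    have "continuous_on {t1..t2} (\<lambda>t. K t h0)"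
      unfolding K_def
      by (intro blinfun.continuous_on continuous_on_compose2[OF DPhi_cont] continuous_intros)
        (auto intro: P_scale w)
    moreover have "K t1 h0 \<le> (1 - \<alpha>) * K t1 h0 + \<alpha> * K t2 h0"
      using mult_left_mono[of "K t1 h0" "K t2 h0" \<alpha>] h0(2) \<alpha>(1) by (simp add: algebra_simps)
    moreover have "(1 - \<alpha>) * K t1 h0 + \<alpha> * K t2 h0 \<le> K t2 h0"
      using mult_left_mono[of "K t1 h0" "K t2 h0" "1 - \<alpha>"] h0(2) \<alpha>(1) by (simp add: algebra_simps)
    ultimately obtain t where t: "t1 \<le> t" "t \<le> t2" "K t h0 = (1 - \<alpha>) * K t1 h0 + \<alpha> * K t2 h0"
      using IVT'[of "\<lambda>t. K t h0" t1 _ t2] t12(2) by blast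
    have "K t h = (1 - \<alpha>) * K t1 h + \<alpha> * K t2 h" if h: "h \<in> P" for h
    proof -
      define \<beta> where "\<beta> = (K t2 h - K t1 h) / (K t2 h0 - K t1 h0)"
      \<comment> \<open>Subtracting this multiple of \<open>h0\<close> makes the end values at
        \<open>g\<close> equal, so \<open>K_min\<close> and \<open>K_max\<close> force
        \<open>K t g\<close> to be the same number. Hence agreement with the convex combination at
        \<open>h0\<close> carries over to every \<open>h\<close>.\<close>
      define g where "g = h + (- \<beta>) *\<^sub>R h0"
      have "g \<in> P" using h h0(1) by (simp add: g_def P_add P_scale del: scaleR_minus_left)
      have Kg: "K t' g = K t' h - \<beta> * K t' h0" for t' unfolding g_def K_add K_scale by simp
      have "\<beta> * (K t2 h0 - K t1 h0) = K t2 h - K t1 h" using h0(2) by (simp add: \<beta>_def)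
      then have "K t1 g = K t2 g" unfolding Kg by (simp add: algebra_simps)
      then have "K t g = K t1 g" using K_min[OF \<open>g \<in> P\<close>, of t] K_max[OF \<open>g \<in> P\<close>, of t] t by simp
      then have "K t h = K t1 g + \<beta> * K t h0" unfolding Kg[of t] by simp
      also have "\<dots> = (1 - \<alpha>) * (K t1 g + \<beta> * K t1 h0) + \<alpha> * (K t1 g + \<beta> * K t2 h0)"
        unfolding t(3) by (simp add: algebra_simps)
      also have "\<dots> = (1 - \<alpha>) * (K t1 g + \<beta> * K t1 h0) + \<alpha> * (K t2 g + \<beta> * K t2 h0)"
        using \<open>K t1 g = K t2 g\<close> by simp
      also have "\<dots> = (1 - \<alpha>) * K t1 h + \<alpha> * K t2 h" unfolding Kg by simp
      finally show ?thesis .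
    qed
    with t show ?thesis by (intro bexI[of _ t]) auto
  qed
  then obtain t where t: "t \<in> {t1..t2}" "\<forall>h\<in>P. K t h = (1 - \<alpha>) * K t1 h + \<alpha> * K t2 h" by blast
  have lower: "- (2 * e) \<le> K t h" if "h \<in> B" for h using t(2) \<alpha>(2) that by (simp add: B_def)
  have "\<bar>K t h\<bar> \<le> 2 * e" if h: "h \<in> P" "norm h \<le> 1" for h
  proof -
    have "h \<in> B" "- 1 *\<^sub>R h \<in> B" using h P_scale[OF h(1), of "- 1"] by (auto simp: B_def)
    from lower[OF this(1)] lower[OF this(2)] show ?thesis unfolding K_scale by simp
  qed
  then show ?thesis using t(1) t12(1) max[OF t(1)] unfolding K_def by (intro exI[of _ t]) auto
qed

lemma dual_norm_on_bounds:
  assumes b: "\<And>h. h \<in> P \<Longrightarrow> norm h \<le> 1 \<Longrightarrow> \<bar>D h\<bar> \<le> b" and "D 0 = 0"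
  shows "0 \<le> dual_norm_on P D" "dual_norm_on P D \<le> b"
proof -
  have bdd: "bdd_above ((\<lambda>v. \<bar>D v\<bar>) ` {v \<in> P. norm v \<le> 1})"
    using b by (intro bdd_aboveI2[where M = b]) auto
  have "\<bar>D 0\<bar> \<le> dual_norm_on P D"
    unfolding dual_norm_on_def by (rule cSUP_upper[OF _ bdd]) (simp add: zero_P)
  then show "0 \<le> dual_norm_on P D" by simp
  show "dual_norm_on P D \<le> b"
    unfolding dual_norm_on_def by (rule cSUP_least) (use zero_P b in auto)
qed

text \<open>The bound on \<open>t\<close> times the derivative gives dual norm at most
  \<open>2 * e / t\<close>. Since \<open>\<Phi> u \<ge> a\<close> forces
  \<open>t \<ge> \<rho>\<close>, the weighted norm \<open>(1 + t) * (2 * e / t)\<close> is bounded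
  by a fixed multiple of \<open>e\<close>.\<close>

lemma almost_critical_point:
  assumes P: "complete P" and c: "c_N P T I = ereal c" and e: "e > 0"
    and \<rho>: "\<rho> > 0" "\<forall>u\<in>P. norm u < \<rho> \<longrightarrow> \<Phi> u < a"
  shows "\<exists>u\<in>P. c \<le> \<Phi> u \<and> \<Phi> u \<le> c + e \<and> 0 \<le> dual_norm_on P (DJ (m u)) \<and>
    (1 + norm u) * dual_norm_on P (DJ (m u)) \<le> (1 / \<rho> + 1) * (2 * e)"
proof -
  obtain w where w: "w \<in> P" "norm w = 1" "\<Psi> w \<le> c + e"
    "\<forall>w'\<in>P. norm w' = 1 \<longrightarrow> \<Psi> w \<le> \<Psi> w' + e * dist w w'"
    using Psi_near_minimizer[OF P c e] by blast
  have w0: "w \<noteq> 0" using w(2) by auto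
  obtain t where t: "t > 0" "\<Phi> (t *\<^sub>R w) = \<Psi> w"
    "\<forall>h\<in>P. norm h \<le> 1 \<longrightarrow> \<bar>DJ (m (t *\<^sub>R w)) (t *\<^sub>R h)\<bar> \<le> 2 * e"
    using single_maximizer[OF w(1,2) e w(4)] by blast
  define u where "u = t *\<^sub>R w"
  have u: "u \<in> P" "norm u = t" using w t by (auto simp: u_def P_scale)
  have "\<not> \<Phi> u < a" using t(2) Psi_ge_a[OF w(1) w0] by (simp add: u_def)
  then have "\<rho> \<le> t" using \<rho>(2) u by (metis not_le)
  have "\<bar>DJ (m u) h\<bar> \<le> 2 * e / t" if "h \<in> P" "norm h \<le> 1" for h
  proof -
    have "t * \<bar>DJ (m u) h\<bar> \<le> 2 * e" using t(1,3) that
      by (auto simp: u_def blinfun.scaleR_right abs_mult)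
    then show ?thesis using t(1) by (simp add: field_simps)
  qed
  note dual = dual_norm_on_bounds[of "DJ (m u)", OF this blinfun.zero_right]
  have "(1 + norm u) * dual_norm_on P (DJ (m u)) \<le> (1 + t) * (2 * e / t)"
    unfolding u(2) using dual(2) t(1) by (intro mult_left_mono) auto
  also have "\<dots> = (1 / t + 1) * (2 * e)" using t(1) by (simp add: field_simps)
  also have "\<dots> \<le> (1 / \<rho> + 1) * (2 * e)"
    using \<open>\<rho> \<le> t\<close> \<rho>(1) e by (intro mult_right_mono add_right_mono divide_left_mono) auto
  finally have "(1 + norm u) * dual_norm_on P (DJ (m u)) \<le> (1 / \<rho> + 1) * (2 * e)" .
  moreover have "c \<le> \<Phi> u" using Psi_ge_c_N[OF w(1) w0] c t(2) by (simp add: u_def)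
  ultimately show ?thesis using dual(1) w(3) t(2) u(1) by (intro bexI[of _ u]) (auto simp: u_def)
qed

lemma cerami_sequence_exists:
  assumes P: "complete P" and c: "c_N P T I = ereal c"
  shows "\<exists>U. cerami_sequence_on P \<Phi> c U"
proof -
  obtain \<rho> where \<rho>: "\<rho> > 0" "\<forall>u\<in>P. norm u < \<rho> \<longrightarrow> \<Phi> u < a" using small_ball by blast
  define e where "e n = inverse (real (Suc n))" for n
  have "\<exists>u. u \<in> P \<and> c \<le> \<Phi> u \<and> \<Phi> u \<le> c + e n \<and> 0 \<le> dual_norm_on P (DJ (m u)) \<and>
    (1 + norm u) * dual_norm_on P (DJ (m u)) \<le> (1 / \<rho> + 1) * (2 * e n)" for n
  proof -
    have "e n > 0" by (simp add: e_def)
    from almost_critical_point[OF P c this \<rho>] show ?thesis by blast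
  qed
  then obtain U where U: "\<And>n. U n \<in> P" "\<And>n. c \<le> \<Phi> (U n)" "\<And>n. \<Phi> (U n) \<le> c + e n"
    "\<And>n. 0 \<le> dual_norm_on P (DJ (m (U n)))"
    "\<And>n. (1 + norm (U n)) * dual_norm_on P (DJ (m (U n))) \<le> (1 / \<rho> + 1) * (2 * e n)"
    by metis
  have e_lim: "e \<longlonglongrightarrow> 0" unfolding e_def by (rule LIMSEQ_inverse_real_of_nat)
  have "(\<lambda>n. (1 / \<rho> + 1) * (2 * e n)) \<longlonglongrightarrow> (1 / \<rho> + 1) * (2 * 0)"
    by (intro tendsto_mult tendsto_const e_lim)
  then have bound: "(\<lambda>n. (1 / \<rho> + 1) * (2 * e n)) \<longlonglongrightarrow> 0" by simp
  have "(\<lambda>n. (1 + norm (U n)) * dual_norm_on P (DJ (m (U n)))) \<longlonglongrightarrow> 0"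
    by (intro tendsto_sandwich[OF _ _ tendsto_const bound] always_eventually allI) (simp_all add: U)
  moreover
  have "(\<lambda>n. c + e n) \<longlonglongrightarrow> c + 0" by (intro tendsto_add tendsto_const e_lim)
  then have upper: "(\<lambda>n. c + e n) \<longlonglongrightarrow> c" by simp
  have "(\<lambda>n. \<Phi> (U n)) \<longlonglongrightarrow> c"
    by (intro tendsto_sandwich[OF _ _ tendsto_const upper] always_eventually allI) (simp_all add: U)
  moreover have "\<forall>n. (\<Phi> has_derivative blinfun_apply (DJ (m (U n)))) (at (U n) within P)"
    using Phi_deriv U(1) by blast
  ultimately have "cerami_sequence_on P \<Phi> c U"
    unfolding cerami_sequence_on_def using U(1)
    by (intro conjI exI[of _ "\<lambda>n. blinfun_apply (DJ (m (U n)))"]) auto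
  then show ?thesis by blast
qed

end

theorem theorem3p3:
  fixes P T :: "'a::banach set"
    and ip :: "'a \<Rightarrow> 'a \<Rightarrow> real"
    and I :: "'a \<Rightarrow> real"
    and r a :: real
  assumes reflexive: "reflexive_space TYPE('a)"
    and direct_sum: "topological_direct_sum P T"
    and hilbert: "hilbert_subspace P ip"
    and norm_split: "\<And>u. (norm u)\<^sup>2 = (norm (plus_part P T u))\<^sup>2 + (norm (tilde_part P T u))\<^sup>2"
    and J_C1: "C1_functional (J_fun P T I)"
    and I1: "C1_functional I" "\<And>u. I u \<ge> I 0" "I 0 = 0"
    and I2: "\<And>U u. T_tendsto P T U u \<Longrightarrow> liminf (\<lambda>n. ereal (I (U n))) \<ge> ereal (I u)"
    and I3: "\<And>U u. T_tendsto P T U u \<Longrightarrow> (\<lambda>n. I (U n)) \<longlonglongrightarrow> I u \<Longrightarrow> U \<longlonglongrightarrow> u"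
    and I4: "filterlim (\<lambda>u. norm (plus_part P T u) + I u) at_top at_infinity"
    and I5: "\<And>u v. u \<in> M_set P T I \<Longrightarrow> v \<in> T - {0} \<Longrightarrow> I u < I (u + v)"
    and I6: "r > 0" "(INF u\<in>{u\<in>P. norm u = r}. ereal (J_fun P T I u)) = ereal a" "a > 0"
    and I7: "\<And>(t :: nat \<Rightarrow> real) U u.
        filterlim t at_top sequentially \<Longrightarrow>
        (\<lambda>n. plus_part P T (U n)) \<longlonglongrightarrow> plus_part P T u \<Longrightarrow> plus_part P T u \<noteq> 0 \<Longrightarrow>
        filterlim (\<lambda>n. I (t n *\<^sub>R U n) / (t n)\<^sup>2) at_top sequentially"
    and I8: "\<And>u t v. u \<in> N_set P T I \<Longrightarrow> t \<ge> 0 \<Longrightarrow> v \<in> T \<Longrightarrow>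
        (t\<^sup>2 - 1) / 2 * frechet_derivative I (at u) u + I u - I (t *\<^sub>R u + v) =
        (t\<^sup>2 - 1) / 2 * frechet_derivative I (at u) u + t * frechet_derivative I (at u) v
          + I u - I (t *\<^sub>R u + v) \<and>
        (t\<^sup>2 - 1) / 2 * frechet_derivative I (at u) u + t * frechet_derivative I (at u) v
          + I u - I (t *\<^sub>R u + v) \<le> 0"
  shows "(\<exists>c. c_M P T I r = ereal c \<and> c \<ge> a \<and> a > 0 \<and>
              (\<exists>U. cerami_sequence_on P (Jtilde P T I) c U)) \<and>
         c_M P T I r = c_N P T I"
proof -
  interpret mountain_pass_functional P T I r a
  proof
    show "I u \<ge> 0" for u using I1(2)[of u] I1(3) by simp
    show "(t\<^sup>2 - 1) / 2 * frechet_derivative I (at u) u + I u - I (t *\<^sub>R u + v) \<le> 0"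
      if "u \<in> N_set P T I" "t \<ge> 0" "v \<in> T" for u t v
      using I8[OF that] by linarith
  qed (fact assms)+
  obtain c where c: "c_N P T I = ereal c" "a \<le> c" by (rule c_N_real)
  have "complete P" using hilbert by (simp add: hilbert_subspace_def)
  then have "\<exists>U. cerami_sequence_on P (Jtilde P T I) c U" using c(1) by (rule cerami_sequence_exists)
  with c a_pos c_M_eq_c_N show ?thesis by simp
qed

end
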